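(* There exist universal constants $c_{\mathrm{suppr}},c_{\mathrm{decay}},\bar C>0$ such that the following holds for every constant $C_\star\ge\bar C$. Let $n\ge 3$, $m=n^3$, $\rho\ge 1$, $\varepsilon=1/(\rho n^2)$, let $s\in[1,n]$ be an integer, and let $\Gamma$ be the $n\times m$ standard Gaussian matrix. Let $\tilde s,r$ be integers with $1\le \tilde s\le n/2$ and $8\le r\le n-\tilde s$, assume that the event $\mathcal{E}^{(K)}(r,\tilde s)$ (defined in the context with the constant $C_\star$) holds, and assume $$4\rho\, C_\star\sqrt r\le c_{\mathrm{suppr}}\,n.$$ Then for every $A\in\mathcal{A}_\varepsilon$, with exposed realization $\omega=\Gamma_{S(A)}$, and every $k\in\{0,1,\dots,\tilde s\}$, $$p_k(A;\omega)=\gamma_n\bigl(4\rho\,\mathcal{P}^{(k)}(A;\omega)\bigr)\le 2\binom{n}{k}^2\exp(-c_{\mathrm{decay}}\,r).$$ Consequently, $$\sum_{k=0}^{\tilde s}p_k(A;\omega)\le 2(\tilde s+1)\exp(-c_{\mathrm{decay}}r)\binom{n}{\tilde s}^2\le 2(\tilde s+1)\exp(-c_{\mathrm{decay}}r)\Bigl(\frac{en}{\tilde s}\Bigr)^{2\tilde s}.$$ In particular, if $c_{\mathrm{decay}}\,r\ge 4\tilde s\log\bigl(\frac{en}{\tilde s}\bigr)+\log 16$, then $\sum_{k=0}^{\tilde s}p_k(A;\omega)\le\frac14$.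
   Context: $\Gamma=[g_1\cdots g_m]\in\mathbb{R}^{n\times m}$ has independent $N(0,1)$ entries; $\gamma_n$ is the standard Gaussian measure on $\mathbb{R}^n$. For a vector $x$, $\operatorname{supp}(x)$ is the set of indices of its nonzero coordinates. $\mathcal{A}_\varepsilon$ is the set of matrices $A\in\mathbb{R}^{m\times n}$ with all entries in $\varepsilon\mathbb{Z}$ such that every column $A^{(i)}$ satisfies $\|A^{(i)}\|_1\le 1$ and $|\operatorname{supp}(A^{(i)})|\le n$. For such $A$, $S(A)=\bigcup_{i=1}^n\operatorname{supp}(A^{(i)})\subset[m]$. For $J\subset[m]$, $\Gamma_J$ is the submatrix of the columns of $\Gamma$ indexed by $J$; for a matrix $B$ with $m$ rows, $B_J$ is its restriction to the rows in $J$. $K/U$ decomposition at threshold $1/s$: for $A\in\mathbb{R}^{m\times n}$, let $F_1(A)=A^{(K)}$ be obtained from $A$ by keeping the entries with $|A_{ji}|\ge 1/s$ and replacing the others by $0$, and let $F_2(A)=A^{(U)}=A-A^{(K)}$. For $A\in\mathcal{A}_\varepsilon$ and $\omega=\Gamma_{S(A)}$, set, for $i\in[n]$, $v_i=v_i(A;\omega)=\omega\,F_{1}(A)_{S(A)}e_i\in\mathbb{R}^n$, $u_i=\omega\,F_{2}(A)_{S(A)}e_i\in\mathbb{R}^n$, and $w_i=v_i$, $w_{n+i}=u_i$. For $I\subset[2n]$ with $|I|=n$, $\mathcal{P}_I(A;\omega)=\operatorname{conv}\{\pm w_i:i\in I\}$, and $$\mathcal{P}^{(k)}(A;\omega)=\bigcup_{I\subset[2n],\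 |I|=n,\ |I\cap\{n+1,\dots,2n\}|=k}\mathcal{P}_I(A;\omega).$$ Suppression event: for $A\in\mathcal{A}_\varepsilon$, $\mathcal{E}_A^{(K)}(r,\tilde s)$ is the event that for every $k\in\{0,\dots,\tilde s\}$ and every $I_1\subset[n]$ with $|I_1|=n-k$, if the vectors $\{v_i(A;\Gamma_{S(A)}):i\in I_1\}$ are linearly independent, then for every $J\subset I_1$ with $|J|=r$, writing $\sigma_{I_1,J}$ for the ordering of $I_1$ that lists $I_1\setminus J$ in increasing order followed by $J$ in increasing order, at least $r/2$ of the indices $\ell\in\{n-k-r+1,\dots,n-k\}$ satisfy $$\operatorname{dist}\bigl(v_{\sigma_{I_1,J}(\ell)},\operatorname{span}\{v_{\sigma_{I_1,J}(t)}:t<\ell\}\bigr)\le C_\star\sqrt r .$$ Then $\mathcal{E}^{(K)}(r,\tilde s)=\bigcap_{A\in\mathcal{A}_\varepsilon}\mathcal{E}_A^{(K)}(r,\tilde s)$. *)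

theory Defs
  imports "HOL-Probability.Probability" "HOL-Library.Function_Algebras"
begin

text \<open>
  The dimension \<open>n\<close> is quantified inside the theorem, under the universal constants, so it
  cannot be a type. A vector of \<open>\<real>\<^sup>n\<close> is a function \<^typ>\<open>nat \<Rightarrow> real\<close> vanishing outside
  \<open>{1..n}\<close>; a matrix with row set \<open>R\<close> and column set \<open>C\<close> is a function on pairs
  (row, column), relevant on \<open>R \<times> C\<close>. All indices start at 1.
\<close>

text \<open>The pointwise vector space structure makes \<^const>\<open>span\<close>, \<^const>\<open>independent\<close>
  and \<open>convex hull\<close> available for such vectors. The library metric on functions is not the
  Euclidean one and is not used.\<close>

instantiation "fun" :: (type, real_vector) real_vector
begin

definition scaleR_fun :: "real \<Rightarrow> ('a \<Rightarrow> 'b) \<Rightarrow> 'a \<Rightarrow> 'b"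
  where "scaleR_fun c f = (\<lambda>x. c *\<^sub>R f x)"

instance
  by standard (simp_all add: scaleR_fun_def fun_eq_iff scaleR_add_right scaleR_add_left)

end

type_synonym vec = "nat \<Rightarrow> real"
type_synonym mat = "nat \<times> nat \<Rightarrow> real"

definition euclid_dist_set :: "nat \<Rightarrow> vec \<Rightarrow> vec set \<Rightarrow> real"
  where "euclid_dist_set n x V = (INF y\<in>V. L2_set (\<lambda>a. x a - y a) {1..n})"

definition std_gauss :: "real measure"
  where "std_gauss = density lborel (\<lambda>x. ennreal (std_normal_density x))"

text \<open>The law of the standard Gaussian matrix, with the matrix itself as the outcome.\<close>

definition gauss_matrix :: "nat \<Rightarrow> nat \<Rightarrow> mat measure"
  where "gauss_matrix n m = (\<Pi>\<^sub>M p\<in>{1..n} \<times> {1..m}. std_gauss)"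

text \<open>Points of the product space are \<^const>\<open>undefined\<close> outside \<open>{1..n}\<close>, whereas vectors
  vanish there.\<close>

definition gauss_measure :: "nat \<Rightarrow> vec set \<Rightarrow> real"
  where "gauss_measure n B =
    (let G = (\<Pi>\<^sub>M a\<in>{1..n}. std_gauss)
     in measure G {x \<in> space G. (\<lambda>a. if a \<in> {1..n} then x a else 0) \<in> B})"

definition col_supp :: "nat \<Rightarrow> mat \<Rightarrow> nat \<Rightarrow> nat set"
  where "col_supp m A i = {j \<in> {1..m}. A (j, i) \<noteq> 0}"

definition A_eps :: "nat \<Rightarrow> nat \<Rightarrow> real \<Rightarrow> mat set"
  where "A_eps n m \<epsilon> =
    {A \<in> ({1..m} \<times> {1..n}) \<rightarrow>\<^sub>E {\<epsilon> * of_int z |z :: int. True}.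
       \<forall>i\<in>{1..n}. (\<Sum>j\<in>{1..m}. \<bar>A (j, i)\<bar>) \<le> 1 \<and> card (col_supp m A i) \<le> n}"

definition S_set :: "nat \<Rightarrow> nat \<Rightarrow> mat \<Rightarrow> nat set"
  where "S_set n m A = (\<Union>i\<in>{1..n}. col_supp m A i)"

text \<open>Submatrices keep their original row and column labels.\<close>

definition sub_cols :: "nat \<Rightarrow> nat set \<Rightarrow> mat \<Rightarrow> mat"
  where "sub_cols n J \<Gamma> = restrict \<Gamma> ({1..n} \<times> J)"

definition sub_rows :: "nat \<Rightarrow> nat set \<Rightarrow> mat \<Rightarrow> mat"
  where "sub_rows n J B = restrict B (J \<times> {1..n})"

definition F1 :: "nat \<Rightarrow> mat \<Rightarrow> mat"
  where "F1 s A = (\<lambda>p. if \<bar>A p\<bar> \<ge> 1 / real s then A p else 0)"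

definition F2 :: "nat \<Rightarrow> mat \<Rightarrow> mat"
  where "F2 s A = A - F1 s A"

text \<open>\<open>prod_col n J \<omega> B i\<close> is \<open>\<omega> B e\<^sub>i\<close> for \<open>\<omega>\<close> of shape \<open>[n] \<times> J\<close>
  and \<open>B\<close> of shape \<open>J \<times> [n]\<close>.\<close>

definition prod_col :: "nat \<Rightarrow> nat set \<Rightarrow> mat \<Rightarrow> mat \<Rightarrow> nat \<Rightarrow> vec"
  where "prod_col n J \<omega> B i =
    (\<lambda>a. if a \<in> {1..n} then \<Sum>j\<in>J. \<omega> (a, j) * B (j, i) else 0)"

definition v_vec :: "nat \<Rightarrow> nat \<Rightarrow> nat \<Rightarrow> mat \<Rightarrow> mat \<Rightarrow> nat \<Rightarrow> vec"
  where "v_vec n m s A \<omega> i =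
    prod_col n (S_set n m A) \<omega> (sub_rows n (S_set n m A) (F1 s A)) i"

definition u_vec :: "nat \<Rightarrow> nat \<Rightarrow> nat \<Rightarrow> mat \<Rightarrow> mat \<Rightarrow> nat \<Rightarrow> vec"
  where "u_vec n m s A \<omega> i =
    prod_col n (S_set n m A) \<omega> (sub_rows n (S_set n m A) (F2 s A)) i"

definition w_vec :: "nat \<Rightarrow> nat \<Rightarrow> nat \<Rightarrow> mat \<Rightarrow> mat \<Rightarrow> nat \<Rightarrow> vec"
  where "w_vec n m s A \<omega> i =
    (if i \<le> n then v_vec n m s A \<omega> i else u_vec n m s A \<omega> (i - n))"

definition P_I :: "nat \<Rightarrow> nat \<Rightarrow> nat \<Rightarrow> nat set \<Rightarrow> mat \<Rightarrow> mat \<Rightarrow> vec set"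
  where "P_I n m s I A \<omega> = convex hull (\<Union>i\<in>I. {w_vec n m s A \<omega> i, - w_vec n m s A \<omega> i})"

definition P_k :: "nat \<Rightarrow> nat \<Rightarrow> nat \<Rightarrow> nat \<Rightarrow> mat \<Rightarrow> mat \<Rightarrow> vec set"
  where "P_k n m s k A \<omega> =
    (\<Union>I\<in>{I. I \<subseteq> {1..2*n} \<and> card I = n \<and> card (I \<inter> {n+1..2*n}) = k}. P_I n m s I A \<omega>)"

text \<open>Each \<^const>\<open>P_k\<close> is a finite union of polytopes, so the measure below is that of a
  Borel set.\<close>

definition p_k :: "nat \<Rightarrow> nat \<Rightarrow> nat \<Rightarrow> real \<Rightarrow> nat \<Rightarrow> mat \<Rightarrow> mat \<Rightarrow> real"
  where "p_k n m s \<rho> k A \<omega> = gauss_measure n ((\<lambda>x. (4 * \<rho>) *\<^sub>R x) ` P_k n m s k A \<omega>)"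

definition indep_family :: "(nat \<Rightarrow> vec) \<Rightarrow> nat set \<Rightarrow> bool"
  where "indep_family v I \<longleftrightarrow> inj_on v I \<and> independent (v ` I)"

definition sigma_ord :: "nat set \<Rightarrow> nat set \<Rightarrow> nat \<Rightarrow> nat"
  where "sigma_ord I1 J l = (sorted_list_of_set (I1 - J) @ sorted_list_of_set J) ! (l - 1)"

definition E_A :: "nat \<Rightarrow> nat \<Rightarrow> nat \<Rightarrow> real \<Rightarrow> nat \<Rightarrow> nat \<Rightarrow> mat \<Rightarrow> mat set"
  where "E_A n m s Cstar r st A =
    {\<Gamma> \<in> space (gauss_matrix n m).
       let v = v_vec n m s A (sub_cols n (S_set n m A) \<Gamma>) in
       \<forall>k\<in>{0..st}. \<forall>I1. I1 \<subseteq> {1..n} \<and> card I1 = n - k \<and> indep_family v I1 \<longrightarrow>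
         (\<forall>J. J \<subseteq> I1 \<and> card J = r \<longrightarrow>
            real (card {l \<in> {n - k - r + 1..n - k}.
              euclid_dist_set n (v (sigma_ord I1 J l))
                (span {v (sigma_ord I1 J t) |t. 1 \<le> t \<and> t < l}) \<le> Cstar * sqrt (real r)})
            \<ge> real r / 2)}"

definition E_K :: "nat \<Rightarrow> nat \<Rightarrow> real \<Rightarrow> nat \<Rightarrow> real \<Rightarrow> nat \<Rightarrow> nat \<Rightarrow> mat set"
  where "E_K n m \<epsilon> s Cstar r st = (\<Inter>A\<in>A_eps n m \<epsilon>. E_A n m s Cstar r st A)"

end

theory Submission imports Defs begin

text \<open>
  Fix \<open>k\<close> and an index set \<open>I\<close> with \<open>n - k\<close> indices in \<open>{1..n}\<close>. The polytope
  \<open>4\<rho> P\<^sub>I\<close> consists of the points \<open>\<Sum>\<^sub>i b\<^sub>i w\<^sub>i\<close> with \<open>\<Sum>\<^sub>i \<bar>b\<^sub>i\<bar> \<le> 4\<rho>\<close>. If the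
  vectors \<open>w\<^sub>i\<close> are dependent, it lies in a hyperplane and has measure zero. Otherwise let
  \<open>p\<^sub>i\<close> be the dual basis, so that \<open>b\<^sub>i = \<langle>p\<^sub>i, x\<rangle>\<close>.

  On a set \<open>J\<close> of \<open>r\<close> indices taken at random among the \<open>n - k \<ge> n/2\<close> indices of the \<open>v\<^sub>i\<close>,
  the coefficients have average total size at most \<open>4\<rho>r/(n - k)\<close>, which is \<open>O(\<rho> r/n)\<close>. On the other
  hand the suppression event provides at least \<open>r/2\<close> indices \<open>l \<in> J\<close> for which \<open>w\<^sub>l\<close> has distance
  at most \<open>D = C\<^sub>\<star> \<surd>r\<close> from the span of the \<open>v\<^sub>i\<close> listed before it; adding the \<open>u\<^sub>i\<close> with
  \<open>n + i \<in> I\<close> to this span can only decrease the distance, to \<open>d\<^sub>l \<le> D\<close>. For a Gaussian vector \<open>x\<close>, conditionally on the later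
  coefficients, \<open>b\<^sub>l\<close> is Gaussian of standard deviation \<open>1/d\<^sub>l \<ge> 1/D\<close>. Hence the
  coefficients with these indices are typically of size at least \<open>1/D\<close>, their sum is
  at least of order \<open>r/D\<close>, and this exceeds \<open>O(\<rho> r/n)\<close> as soon as \<open>\<rho> D/n\<close> is a small constant.
  Points of the polytope thus force \<open>r/2\<close> conditionally Gaussian coefficients to be atypically
  small, which has a probability exponentially small in \<open>r\<close>. The factor \<open>(n choose k)\<^sup>2\<close> counts
  the sets \<open>I\<close>.

  Quantitatively, with \<open>\<theta> = 2e\<^sup>4D\<close>, the indicator function of the polytope is bounded by a
  constant times the average over \<open>J\<close> of the products
  \<open>\<Prod>\<^sub>l 1/(1 + (\<theta>\<langle>p\<^sub>l, x\<rangle>)\<^sup>2)\<close> over the indices \<open>l\<close> provided by the event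
  (\<open>subset_average_exp_ge\<close>, \<open>has_majorant_independent\<close>). Since \<open>1/(1 + b\<^sup>2)\<close> is the
  characteristic function of the Laplace distribution, exchanging the order of integration turns
  the Gaussian expectation of such a product into the integral of
  \<open>exp (- \<bar>\<Sum>\<^sub>l t\<^sub>l p\<^sub>l\<bar>\<^sup>2 / 2)\<close> against independent Laplace variables \<open>t\<^sub>l\<close>
  (\<open>gauss_cauchy_product_eq\<close>). By Bessel's inequality the quadratic form is bounded below by a
  triangular one with diagonal entries \<open>1/d\<^sub>l\<close>, which is integrated one variable at a time
  (\<open>nn_integral_laplace_triangular_le\<close>). This route avoids rotating the Gaussian measure, which
  would be awkward for a product measure over a varying index set.
\<close>

section \<open>The Laplace distribution\<close>

text \<open>
  The density is bounded by \<open>1/2\<close> and the characteristic function is positive and decays only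
  polynomially. These are the two properties used: the first on the Fourier side, the second for
  dominating \<open>exp (- \<bar>b\<bar>)\<close>.
\<close>

definition laplace :: "real measure"
  where "laplace = density lborel (\<lambda>t. ennreal (exp (- \<bar>t\<bar>) / 2))"

lemma space_laplace [simp]: "space laplace = UNIV"
  and sets_laplace [measurable_cong]: "sets laplace = sets borel"
  by (simp_all add: laplace_def)

text \<open>
  The integrand is \<open>exp (z t)\<close> with \<open>z = - 1 + \<i>b\<close>, whose primitive \<open>exp (z t) / z\<close> vanishes at infinity.
\<close>

lemma has_bochner_integral_exp_iexp_half_line:
  fixes b :: real
  shows "has_bochner_integral lborel
    (\<lambda>t. indicator {0<..} t *\<^sub>R (complex_of_real (exp (- t)) * iexp (b * t))) (1 / (1 - \<i> * b))"
proof -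
  let ?z = "- 1 + \<i> * complex_of_real b"
  let ?f = "\<lambda>t::real. exp (?z * complex_of_real t)"
  have z: "?z \<noteq> 0"
    by (simp add: complex_eq_iff)
  have n: "cmod (?f t) = exp (- t)" for t
    by simp
  have f_eq: "?f t = complex_of_real (exp (- t)) * iexp (b * t)" for t
    by (simp add: exp_of_real[symmetric] exp_add[symmetric] algebra_simps)
  have int: "set_integrable lborel {0<..} ?f"
    using integrable_I0i_exp_mscale[of 1] unfolding set_integrable_def
    by (rule Bochner_Integration.integrable_bound)
       (auto simp: indicator_def)
  have "(LBINT t=0..\<infinity>. ?f t) = 0 - 1 / ?z"
  proof (rule interval_integral_FTC_integrable[where F = "\<lambda>t. ?f t / ?z"])
    show "((\<lambda>t. ?f t / ?z) has_vector_derivative ?f x) (at x)" for x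
      using z by (auto intro!: derivative_eq_intros has_vector_derivative_real_field)
    show "isCont ?f x" for x
      by (intro continuous_intros)
    show "set_integrable lborel (einterval 0 \<infinity>) ?f"
      using int by (simp add: einterval_eq zero_ereal_def)
    have "((\<lambda>t. ?f t / ?z) \<longlongrightarrow> ?f 0 / ?z) (at_right 0)"
      using z by (intro tendsto_intros)
    then show "(((\<lambda>t. ?f t / ?z) \<circ> real_of_ereal) \<longlongrightarrow> 1 / ?z) (at_right 0)"
      unfolding zero_ereal_def by (subst ereal_tendsto_simps1) simp
    have "((\<lambda>t. exp (- t) / cmod ?z) \<longlongrightarrow> 0) at_top"
      by real_asymp
    then have "((\<lambda>t. ?f t / ?z) \<longlongrightarrow> 0) at_top"
      by (subst tendsto_norm_zero_iff[symmetric]) (simp only: norm_divide n)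
    then show "(((\<lambda>t. ?f t / ?z) \<circ> real_of_ereal) \<longlongrightarrow> 0) (at_left \<infinity>)"
      by (subst ereal_tendsto_simps1)
  qed simp
  also have "0 - 1 / ?z = 1 / (1 - \<i> * b)"
    using z by (simp add: divide_simps)
  finally have "integral\<^sup>L lborel (\<lambda>t. indicator {0<..} t *\<^sub>R ?f t) = 1 / (1 - \<i> * b)"
    by (simp add: interval_lebesgue_integral_0_infty set_lebesgue_integral_def)
  then show ?thesis
    using int unfolding has_bochner_integral_iff set_integrable_def f_eq by simp
qed

text \<open>
  The two half-lines contribute \<open>1/(1 - \<i>b)\<close> and \<open>1/(1 + \<i>b)\<close>.
\<close>

lemma has_bochner_integral_laplace_density_iexp:
  fixes b :: real
  shows "has_bochner_integral lborel
    (\<lambda>t. complex_of_real (exp (- \<bar>t\<bar>) / 2) * iexp (b * t)) (complex_of_real (1 / (1 + b\<^sup>2)))"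
proof -
  let ?h = "\<lambda>(b::real) (t::real). indicator {0<..} t *\<^sub>R (complex_of_real (exp (- t)) * iexp (b * t))"
  have "has_bochner_integral lborel (\<lambda>t. ?h (- b) (0 + (-1) * t)) ((1 / (1 - \<i> * of_real (- b))) /\<^sub>R \<bar>-1\<bar>)"
    by (rule lborel_has_bochner_integral_real_affine_iff[THEN iffD1])
       (use has_bochner_integral_exp_iexp_half_line[of "- b"] in auto)
  then have neg: "has_bochner_integral lborel (\<lambda>t. ?h (- b) (- t)) (1 / (1 + \<i> * b))"
    by simp
  have "has_bochner_integral lborel (\<lambda>t. (?h b t + ?h (- b) (- t)) / 2)
      ((1 / (1 - \<i> * b) + 1 / (1 + \<i> * b)) / 2)"
    by (intro has_bochner_integral_divide_zero has_bochner_integral_add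
        has_bochner_integral_exp_iexp_half_line neg)
  moreover have "(1 / (1 - \<i> * b) + 1 / (1 + \<i> * b)) / 2 = complex_of_real (1 / (1 + b\<^sup>2))"
  proof -
    have "(1 - \<i> * b) * (1 + \<i> * b) = complex_of_real (1 + b\<^sup>2)"
      by (simp add: algebra_simps power2_eq_square)
    moreover have "1 - \<i> * b \<noteq> 0" "1 + \<i> * b \<noteq> 0"
      by (simp_all add: complex_eq_iff)
    ultimately have *: "1 / (1 - \<i> * b) + 1 / (1 + \<i> * b) = 2 * complex_of_real (1 / (1 + b\<^sup>2))"
      by (simp add: add_frac_eq del: of_real_add)
    show ?thesis
      unfolding * by (rule nonzero_mult_div_cancel_left) simp
  qed
  \<comment> \<open>The half-line integrands both vanish at \<open>0\<close>, where the density does not.\<close>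
  moreover have "AE t in lborel. (?h b t + ?h (- b) (- t)) / 2 =
      complex_of_real (exp (- \<bar>t\<bar>) / 2) * iexp (b * t)"
    using AE_lborel_singleton[of 0] by eventually_elim (auto simp: indicator_def)
  ultimately show ?thesis
    by (subst has_bochner_integral_cong_AE[symmetric]) (auto)
qed

lemma real_distribution_laplace: "real_distribution laplace"
proof -
  have "has_bochner_integral lborel (\<lambda>t. Re (complex_of_real (exp (- \<bar>t\<bar>) / 2) * iexp (0 * t)))
     (Re (complex_of_real (1 / (1 + 0\<^sup>2))))"
    by (intro has_bochner_integral_Re has_bochner_integral_laplace_density_iexp)
  then have "has_bochner_integral lborel (\<lambda>t. exp (- \<bar>t\<bar>) / 2 :: real) 1"
    by simp
  then have "(\<integral>\<^sup>+t. ennreal (exp (- \<bar>t\<bar>) / 2) \<partial>lborel) = 1"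
    by (subst nn_integral_eq_integral) (auto simp: has_bochner_integral_iff)
  then show ?thesis
    by (intro real_distribution.intro prob_spaceI real_distribution_axioms.intro)
       (auto simp: laplace_def emeasure_density)
qed

lemma char_laplace: "char laplace b = complex_of_real (1 / (1 + b\<^sup>2))"
proof -
  have "char laplace b = (CLBINT t. (exp (- \<bar>t\<bar>) / 2) *\<^sub>R iexp (b * t))"
    unfolding char_def laplace_def by (subst integral_density) auto
  also have "\<dots> = complex_of_real (1 / (1 + b\<^sup>2))"
    unfolding scaleR_conv_of_real
    by (rule has_bochner_integral_integral_eq[OF has_bochner_integral_laplace_density_iexp])
  finally show ?thesis .
qed

text \<open>
  Bounding the Laplace density by \<open>1/2\<close> leaves a Gaussian integral, whose value does not depend
  on the shift \<open>a\<close>. This independence is what allows variables to be integrated out successively.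
\<close>

lemma nn_integral_laplace_gaussian_le:
  assumes "c > 0"
  shows "(\<integral>\<^sup>+t. ennreal (exp (- (c * t + a)\<^sup>2 / 2)) \<partial>laplace) \<le> ennreal (sqrt (2 * pi) / (2 * c))"
proof -
  let ?g = "normal_density (- a / c) (1 / c)"
  have g: "exp (- (c * t + a)\<^sup>2 / 2) = sqrt (2 * pi) / c * ?g t" for t
  proof -
    have "(t - - a / c)\<^sup>2 / (2 * (1 / c)\<^sup>2) = (c * t + a)\<^sup>2 / 2"
      using assms by (simp add: field_simps power2_eq_square)
    then show ?thesis
      using assms by (simp add: normal_density_def real_sqrt_mult real_sqrt_divide)
  qed
  have "(\<integral>\<^sup>+t. ennreal (exp (- (c * t + a)\<^sup>2 / 2)) \<partial>laplace)
      = (\<integral>\<^sup>+t. ennreal (exp (- \<bar>t\<bar>) / 2) * ennreal (exp (- (c * t + a)\<^sup>2 / 2)) \<partial>lborel)"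
    unfolding laplace_def by (subst nn_integral_density) auto
  also have "\<dots> \<le> (\<integral>\<^sup>+t. ennreal (sqrt (2 * pi) / (2 * c)) * ennreal (?g t) \<partial>lborel)"
  proof (rule nn_integral_mono)
    fix t
    have "exp (- \<bar>t\<bar>) / 2 * exp (- (c * t + a)\<^sup>2 / 2) \<le> 1 / 2 * exp (- (c * t + a)\<^sup>2 / 2)"
      by (intro mult_right_mono) auto
    also have "\<dots> = sqrt (2 * pi) / (2 * c) * ?g t"
      unfolding g by simp
    finally show "ennreal (exp (- \<bar>t\<bar>) / 2) * ennreal (exp (- (c * t + a)\<^sup>2 / 2))
        \<le> ennreal (sqrt (2 * pi) / (2 * c)) * ennreal (?g t)"
      using assms by (simp add: ennreal_mult[symmetric])
  qed
  also have "\<dots> = ennreal (sqrt (2 * pi) / (2 * c))"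
  proof -
    have "(\<integral>\<^sup>+t. ennreal (?g t) \<partial>lborel) = 1"
      using prob_space.emeasure_space_1[OF prob_space_normal_density[of "1 / c" "- a / c"]] assms
      by (simp add: emeasure_density)
    then show ?thesis
      by (subst nn_integral_cmult) auto
  qed
  finally show ?thesis .
qed

text \<open>
  The variable with the largest index \<open>b\<close> enters only the square with index \<open>b\<close>, because the
  coefficients \<open>c b i\<close> with \<open>i < b\<close> vanish. The other variables act there as a shift, so
  integrating the largest variable first splits off one factor.
\<close>

lemma nn_integral_laplace_triangular_le:
  fixes c :: "nat \<Rightarrow> nat \<Rightarrow> real"
  assumes "finite G" and "\<And>i. i \<in> G \<Longrightarrow> c i i > 0"
    and "\<And>l i. l \<in> G \<Longrightarrow> i \<in> G \<Longrightarrow> i < l \<Longrightarrow> c l i = 0"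
  shows "(\<integral>\<^sup>+t. ennreal (exp (- (\<Sum>i\<in>G. (\<Sum>l\<in>G. t l * c l i)\<^sup>2) / 2)) \<partial>(\<Pi>\<^sub>M l\<in>G. laplace))
    \<le> (\<Prod>i\<in>G. ennreal (sqrt (2 * pi) / (2 * c i i)))"
  using assms
proof (induction G rule: finite_linorder_max_induct)
  case empty
  interpret product_sigma_finite "\<lambda>_::nat. laplace"
    by (simp add: product_sigma_finite_def real_distribution_laplace
        real_distribution.axioms(1) prob_space_imp_sigma_finite)
  show ?case by (subst nn_integral_empty) auto
next
  case (insert b A)
  interpret product_sigma_finite "\<lambda>_::nat. laplace"
    by (simp add: product_sigma_finite_def real_distribution_laplace
        real_distribution.axioms(1) prob_space_imp_sigma_finite)
  have b: "b \<notin> A" using insert by auto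
  have fin: "finite A" by fact
  let ?Q = "\<lambda>t. \<Sum>i\<in>A. (\<Sum>l\<in>A. t l * c l i)\<^sup>2"
  let ?a = "\<lambda>t. \<Sum>l\<in>A. t l * c l b"
  have split: "(\<Sum>i\<in>insert b A. (\<Sum>l\<in>insert b A. (t(b := y)) l * c l i)\<^sup>2) = ?Q t + (c b b * y + ?a t)\<^sup>2"
    for t y
  proof -
    have *: "(\<Sum>l\<in>A. (t(b := y)) l * c l i) = (\<Sum>l\<in>A. t l * c l i)" for i
      using b by (intro sum.cong) auto
    have "c b i = 0" if "i \<in> A" for i
      using insert.prems(2) insert.hyps that by auto
    moreover have "(\<Sum>l\<in>insert b A. (t(b := y)) l * c l i) = c b i * y + (\<Sum>l\<in>A. t l * c l i)" for i
      using * b fin by (simp del: fun_upd_apply add: fun_upd_same mult.commute[of y])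
    ultimately show ?thesis
      using b fin by (simp del: fun_upd_apply add: add.commute)
  qed
  have "(\<integral>\<^sup>+t. ennreal (exp (- (\<Sum>i\<in>insert b A. (\<Sum>l\<in>insert b A. t l * c l i)\<^sup>2) / 2))
          \<partial>(\<Pi>\<^sub>M l\<in>insert b A. laplace))
      = (\<integral>\<^sup>+t. \<integral>\<^sup>+y. ennreal (exp (- (?Q t + (c b b * y + ?a t)\<^sup>2) / 2)) \<partial>laplace \<partial>(\<Pi>\<^sub>M l\<in>A. laplace))"
    by (subst product_nn_integral_insert[OF fin b]) (use split in auto)
  also have "\<dots> = (\<integral>\<^sup>+t. ennreal (exp (- ?Q t / 2)) *
      (\<integral>\<^sup>+y. ennreal (exp (- (c b b * y + ?a t)\<^sup>2 / 2)) \<partial>laplace) \<partial>(\<Pi>\<^sub>M l\<in>A. laplace))"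
    by (subst nn_integral_cmult[symmetric])
       (auto simp: ennreal_mult[symmetric] exp_add[symmetric] add_divide_distrib diff_divide_distrib)
  also have "\<dots> \<le> (\<integral>\<^sup>+t. ennreal (exp (- ?Q t / 2)) * ennreal (sqrt (2 * pi) / (2 * c b b))
      \<partial>(\<Pi>\<^sub>M l\<in>A. laplace))"
    by (intro nn_integral_mono mult_left_mono nn_integral_laplace_gaussian_le insert.prems) auto
  also have "\<dots> = (\<integral>\<^sup>+t. ennreal (exp (- ?Q t / 2)) \<partial>(\<Pi>\<^sub>M l\<in>A. laplace)) * ennreal (sqrt (2 * pi) / (2 * c b b))"
    by (subst nn_integral_multc) auto
  also have "\<dots> \<le> (\<Prod>i\<in>A. ennreal (sqrt (2 * pi) / (2 * c i i))) * ennreal (sqrt (2 * pi) / (2 * c b b))"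
    by (intro mult_right_mono insert.IH insert.prems) auto
  finally show ?case
    using b fin by (simp add: mult.commute)
qed

section \<open>Gaussian expectations of products of Cauchy-type factors\<close>

lemma bessel_inequality:
  fixes y :: "'a \<Rightarrow> real"
  assumes "finite N" "finite G"
    and orth: "\<And>i j. i \<in> G \<Longrightarrow> j \<in> G \<Longrightarrow> (\<Sum>a\<in>N. e i a * e j a) = (if i = j then 1 else 0)"
  shows "(\<Sum>i\<in>G. (\<Sum>a\<in>N. y a * e i a)\<^sup>2) \<le> (\<Sum>a\<in>N. (y a)\<^sup>2)"
proof -
  let ?c = "\<lambda>i. \<Sum>a\<in>N. y a * e i a"
  let ?z = "\<lambda>a. \<Sum>i\<in>G. ?c i * e i a"
  have 1: "(\<Sum>a\<in>N. y a * ?z a) = (\<Sum>i\<in>G. (?c i)\<^sup>2)"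
    unfolding sum_distrib_left power2_eq_square
    by (subst sum.swap) (simp add: sum_distrib_left sum_distrib_right mult_ac)
  have 2: "(\<Sum>a\<in>N. (\<Sum>i\<in>G. c i * e i a)\<^sup>2) = (\<Sum>i\<in>G. (c i)\<^sup>2)" for c
  proof -
    have "(\<Sum>a\<in>N. (\<Sum>i\<in>G. c i * e i a)\<^sup>2) = (\<Sum>a\<in>N. \<Sum>i\<in>G. \<Sum>j\<in>G. (c i * e i a) * (c j * e j a))"
      unfolding power2_eq_square sum_product ..
    also have "\<dots> = (\<Sum>i\<in>G. \<Sum>a\<in>N. \<Sum>j\<in>G. (c i * e i a) * (c j * e j a))"
      by (rule sum.swap)
    also have "\<dots> = (\<Sum>i\<in>G. \<Sum>j\<in>G. \<Sum>a\<in>N. (c i * e i a) * (c j * e j a))"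
      by (intro sum.cong refl sum.swap)
    also have "\<dots> = (\<Sum>i\<in>G. \<Sum>j\<in>G. c i * c j * (\<Sum>a\<in>N. e i a * e j a))"
      by (simp add: sum_distrib_left mult_ac)
    also have "\<dots> = (\<Sum>i\<in>G. \<Sum>j\<in>G. if i = j then c i * c j else 0)"
      by (intro sum.cong refl) (simp add: orth)
    also have "\<dots> = (\<Sum>i\<in>G. (c i)\<^sup>2)"
      using assms(2) by (simp add: power2_eq_square)
    finally show ?thesis .
  qed
  have "0 \<le> (\<Sum>a\<in>N. (y a - ?z a)\<^sup>2)"
    by (intro sum_nonneg) auto
  also have "\<dots> = (\<Sum>a\<in>N. (y a)\<^sup>2) - 2 * (\<Sum>a\<in>N. y a * ?z a) + (\<Sum>a\<in>N. (?z a)\<^sup>2)"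
    by (simp add: power2_diff sum.distrib sum_subtractf sum_distrib_left mult_ac)
  finally show ?thesis
    using 1 2[of ?c] by simp
qed

lemma real_distribution_std_gauss: "real_distribution std_gauss"
  unfolding std_gauss_def by (rule real_dist_normal_dist)

lemma char_std_gauss: "char std_gauss t = complex_of_real (exp (- t\<^sup>2 / 2))"
  by (simp add: std_gauss_def char_std_normal_distribution)

lemma (in prob_space) prob_space_PiM_const: "prob_space (\<Pi>\<^sub>M i\<in>I. M)"
  by (intro prob_space_PiM prob_space_axioms)

text \<open>
  Each factor is written as the Laplace characteristic function at \<open>\<langle>p\<^sub>l, x\<rangle>\<close>. After exchanging
  the integrals the exponent \<open>\<Sum>\<^sub>l t\<^sub>l \<langle>p\<^sub>l, x\<rangle>\<close> is regrouped by the coordinates of \<open>x\<close>, where the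
  Gaussian characteristic function applies coordinatewise.
\<close>

lemma gauss_cauchy_product_eq:
  fixes p :: "nat \<Rightarrow> nat \<Rightarrow> real"
  assumes "finite N" "finite G"
  shows "(LINT x|(\<Pi>\<^sub>M a\<in>N. std_gauss). (\<Prod>l\<in>G. 1 / (1 + (\<Sum>a\<in>N. p l a * x a)\<^sup>2)))
       = (LINT t|(\<Pi>\<^sub>M l\<in>G. laplace). exp (- (\<Sum>a\<in>N. (\<Sum>l\<in>G. t l * p l a)\<^sup>2) / 2))"
proof -
  interpret L: real_distribution laplace by (rule real_distribution_laplace)
  interpret S: real_distribution std_gauss by (rule real_distribution_std_gauss)
  interpret PL: product_sigma_finite "\<lambda>_::nat. laplace"
    by (simp add: product_sigma_finite_def L.sigma_finite_measure_axioms)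
  interpret PS: product_sigma_finite "\<lambda>_::nat. std_gauss"
    by (simp add: product_sigma_finite_def S.sigma_finite_measure_axioms)
  let ?L = "\<Pi>\<^sub>M l\<in>G. laplace" and ?S = "\<Pi>\<^sub>M a\<in>N. std_gauss"
  interpret QL: prob_space ?L by (rule L.prob_space_PiM_const)
  interpret QS: prob_space ?S by (rule S.prob_space_PiM_const)
  interpret pair_prob_space ?S ?L ..
  have sets [measurable_cong]: "sets std_gauss = sets borel" by simp
  let ?b = "\<lambda>x l. \<Sum>a\<in>N. p l a * x a" and ?c = "\<lambda>t a. \<Sum>l\<in>G. t l * p l a"
  have iexp_prod: "(\<Prod>i\<in>A. iexp (g i)) = iexp (sum g A)" if "finite A" for g :: "nat \<Rightarrow> real" and A
    using that by (simp add: exp_sum sum_distrib_left)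
  have swap: "(\<Sum>l\<in>G. ?b x l * t l) = (\<Sum>a\<in>N. ?c t a * x a)" for x t :: "nat \<Rightarrow> real"
    unfolding sum_distrib_right by (subst sum.swap) (simp add: mult_ac)
  have "complex_of_real (LINT x|?S. (\<Prod>l\<in>G. 1 / (1 + (?b x l)\<^sup>2))) = (LINT x|?S. (\<Prod>l\<in>G. char laplace (?b x l)))"
    by (simp only: integral_complex_of_real[symmetric] of_real_prod char_laplace)
  also have "\<dots> = (LINT x|?S. LINT t|?L. (\<Prod>l\<in>G. iexp (?b x l * t l)))"
    unfolding char_def
    by (intro Bochner_Integration.integral_cong refl PL.product_integral_prod[symmetric] assms L.integrable_iexp) auto
  also have "\<dots> = (LINT x|?S. LINT t|?L. iexp (\<Sum>l\<in>G. ?b x l * t l))"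
    by (simp only: iexp_prod[OF assms(2)])
  also have "\<dots> = (LINT t|?L. LINT x|?S. iexp (\<Sum>l\<in>G. ?b x l * t l))"
  proof (rule Fubini_integral[symmetric])
    have [measurable]: "(\<lambda>z. \<Sum>l\<in>G. ?b (fst z) l * snd z l) \<in> borel_measurable (?S \<Otimes>\<^sub>M ?L)"
      by measurable
    show "integrable (?S \<Otimes>\<^sub>M ?L) (\<lambda>(x, t). iexp (\<Sum>l\<in>G. ?b x l * t l))"
      unfolding split_beta'
      by (rule integrable_const_bound[where B = 1]) auto
  qed
  also have "\<dots> = (LINT t|?L. LINT x|?S. (\<Prod>a\<in>N. iexp (?c t a * x a)))"
    by (simp only: iexp_prod[OF assms(1)] swap)
  also have "\<dots> = (LINT t|?L. (\<Prod>a\<in>N. char std_gauss (?c t a)))"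
    unfolding char_def
    by (intro Bochner_Integration.integral_cong refl PS.product_integral_prod assms S.integrable_iexp) auto
  also have "\<dots> = (LINT t|?L. complex_of_real (exp (- (\<Sum>a\<in>N. (?c t a)\<^sup>2) / 2)))"
    by (simp only: char_std_gauss of_real_prod[symmetric] exp_sum[OF assms(1), symmetric]
        sum_negf[symmetric] sum_divide_distrib)
  also have "\<dots> = complex_of_real (LINT t|?L. exp (- (\<Sum>a\<in>N. (?c t a)\<^sup>2) / 2))"
    by (rule integral_complex_of_real)
  finally show ?thesis
    by (simp only: of_real_eq_iff)
qed

text \<open>
  In the orthonormal system \<open>e\<close> the coefficient matrix of the \<open>p\<^sub>l\<close> is triangular. Bessel's inequality
  replaces the full quadratic form by its part along this system.
\<close>

lemma gauss_cauchy_product_le: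
  fixes p e :: "nat \<Rightarrow> nat \<Rightarrow> real"
  assumes fin: "finite N" "finite G"
    and orth: "\<And>i j. i \<in> G \<Longrightarrow> j \<in> G \<Longrightarrow> (\<Sum>a\<in>N. e i a * e j a) = (if i = j then 1 else 0)"
    and tri: "\<And>l i. l \<in> G \<Longrightarrow> i \<in> G \<Longrightarrow> i < l \<Longrightarrow> (\<Sum>a\<in>N. p l a * e i a) = 0"
    and pos: "\<And>i. i \<in> G \<Longrightarrow> (\<Sum>a\<in>N. p i a * e i a) > 0"
  shows "(\<integral>\<^sup>+x. ennreal (\<Prod>l\<in>G. 1 / (1 + (\<Sum>a\<in>N. p l a * x a)\<^sup>2)) \<partial>(\<Pi>\<^sub>M a\<in>N. std_gauss))
      \<le> (\<Prod>i\<in>G. ennreal (sqrt (2 * pi) / (2 * (\<Sum>a\<in>N. p i a * e i a))))"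
proof -
  interpret L: real_distribution laplace by (rule real_distribution_laplace)
  interpret S: real_distribution std_gauss by (rule real_distribution_std_gauss)
  let ?L = "\<Pi>\<^sub>M l\<in>G. laplace" and ?S = "\<Pi>\<^sub>M a\<in>N. std_gauss"
  interpret QL: prob_space ?L by (rule L.prob_space_PiM_const)
  interpret QS: prob_space ?S by (rule S.prob_space_PiM_const)
  have sets [measurable_cong]: "sets std_gauss = sets borel" by simp
  have prod01: "0 \<le> (\<Prod>l\<in>G. 1 / (1 + (f l)\<^sup>2)) \<and> (\<Prod>l\<in>G. 1 / (1 + (f l)\<^sup>2)) \<le> 1" for f :: "nat \<Rightarrow> real"
    by (intro conjI prod_nonneg prod_le_1) (auto simp: add_pos_nonneg divide_le_eq)
  have "(\<integral>\<^sup>+x. ennreal (\<Prod>l\<in>G. 1 / (1 + (\<Sum>a\<in>N. p l a * x a)\<^sup>2)) \<partial>?S)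
      = ennreal (LINT x|?S. (\<Prod>l\<in>G. 1 / (1 + (\<Sum>a\<in>N. p l a * x a)\<^sup>2)))"
    using prod01 by (intro nn_integral_eq_integral QS.integrable_const_bound[where B = 1]) auto
  also have "\<dots> = ennreal (LINT t|?L. exp (- (\<Sum>a\<in>N. (\<Sum>l\<in>G. t l * p l a)\<^sup>2) / 2))"
    by (simp only: gauss_cauchy_product_eq[OF fin])
  also have "\<dots> = (\<integral>\<^sup>+t. ennreal (exp (- (\<Sum>a\<in>N. (\<Sum>l\<in>G. t l * p l a)\<^sup>2) / 2)) \<partial>?L)"
    by (intro nn_integral_eq_integral[symmetric] QL.integrable_const_bound[where B = 1])
       (auto intro!: sum_nonneg)
  also have "\<dots> \<le> (\<integral>\<^sup>+t. ennreal (exp (- (\<Sum>i\<in>G. (\<Sum>l\<in>G. t l * (\<Sum>a\<in>N. p l a * e i a))\<^sup>2) / 2)) \<partial>?L)"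
  proof (intro nn_integral_mono ennreal_leI)
    fix t
    have "(\<Sum>l\<in>G. t l * (\<Sum>a\<in>N. p l a * e i a)) = (\<Sum>a\<in>N. (\<Sum>l\<in>G. t l * p l a) * e i a)" for i
      unfolding sum_distrib_left sum_distrib_right by (subst sum.swap) (simp add: mult_ac)
    then show "exp (- (\<Sum>a\<in>N. (\<Sum>l\<in>G. t l * p l a)\<^sup>2) / 2)
        \<le> exp (- (\<Sum>i\<in>G. (\<Sum>l\<in>G. t l * (\<Sum>a\<in>N. p l a * e i a))\<^sup>2) / 2)"
      using bessel_inequality[OF fin orth, of "\<lambda>a. \<Sum>l\<in>G. t l * p l a"] by simp
  qed
  also have "\<dots> \<le> (\<Prod>i\<in>G. ennreal (sqrt (2 * pi) / (2 * (\<Sum>a\<in>N. p i a * e i a))))"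
    by (intro nn_integral_laplace_triangular_le fin tri pos)
  finally show ?thesis .
qed

section \<open>Euclidean geometry of coordinate functions\<close>

text \<open>
  The Euclidean inner product has to be defined for each \<open>n\<close>, since vectors of all dimensions
  share the type \<^typ>\<open>vec\<close>. It is positive definite only on \<open>coord_space n\<close> below.
\<close>

definition inner_n :: "nat \<Rightarrow> vec \<Rightarrow> vec \<Rightarrow> real"
  where "inner_n n x y = (\<Sum>a\<in>{1..n}. x a * y a)"

definition coord_space :: "nat \<Rightarrow> vec set"
  where "coord_space n = {x. \<forall>a. a \<notin> {1..n} \<longrightarrow> x a = 0}"

lemma scaleR_fun_apply [simp]: "(c *\<^sub>R f) a = c *\<^sub>R f a"
  by (simp add: scaleR_fun_def)

lemma sum_fun_apply: "(\<Sum>i\<in>I. f i) a = (\<Sum>i\<in>I. f i a)" for f :: "'i \<Rightarrow> 'a \<Rightarrow> 'b::comm_monoid_add"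
  by (induction I rule: infinite_finite_induct) auto

lemma inner_n_commute: "inner_n n x y = inner_n n y x"
  by (simp add: inner_n_def mult.commute)

lemma inner_n_simps [simp]:
  "inner_n n (x + y) z = inner_n n x z + inner_n n y z"
  "inner_n n (x - y) z = inner_n n x z - inner_n n y z"
  "inner_n n (c *\<^sub>R x) z = c * inner_n n x z"
  "inner_n n (- x) z = - inner_n n x z"
  "inner_n n 0 z = 0"
  "inner_n n z (x + y) = inner_n n z x + inner_n n z y"
  "inner_n n z (x - y) = inner_n n z x - inner_n n z y"
  "inner_n n z (c *\<^sub>R x) = c * inner_n n z x"
  "inner_n n z (- x) = - inner_n n z x"
  "inner_n n z 0 = 0"
  by (simp_all add: inner_n_def sum.distrib sum_subtractf sum_negf sum_distrib_left algebra_simps)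

lemma inner_n_sum_right: "inner_n n z (\<Sum>i\<in>I. f i) = (\<Sum>i\<in>I. inner_n n z (f i))"
  by (induction I rule: infinite_finite_induct)
    (simp_all del: plus_fun_apply zero_fun_apply)

lemma inner_n_cong:
  assumes "\<And>a. a \<in> {1..n} \<Longrightarrow> x a = y a"
  shows "inner_n n z x = inner_n n z y"
  using assms by (simp add: inner_n_def)

lemma inner_n_self_nonneg: "0 \<le> inner_n n x x"
  by (simp add: inner_n_def sum_nonneg)

text \<open>
  Serves vectors that need not vanish outside \<open>{1..n}\<close>, for which \<open>x = 0\<close> does not follow.
\<close>

lemma inner_n_self_eq_0:
  assumes "inner_n n x x = 0" shows "inner_n n x y = 0"
proof -
  have "\<forall>a\<in>{1..n}. x a * x a = 0"
    using assms unfolding inner_n_def by (subst (asm) sum_nonneg_eq_0_iff) auto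
  then show ?thesis
    by (simp add: inner_n_def)
qed

lemma inner_n_self_pos:
  assumes "x \<in> coord_space n" "x \<noteq> 0" shows "0 < inner_n n x x"
proof (rule ccontr)
  assume "\<not> 0 < inner_n n x x"
  then have "inner_n n x x = 0" using inner_n_self_nonneg[of n x] by simp
  then have "\<forall>a\<in>{1..n}. x a * x a = 0"
    unfolding inner_n_def by (subst (asm) sum_nonneg_eq_0_iff) auto
  with assms show False
    by (auto simp: coord_space_def fun_eq_iff)
qed

lemma L2_set_eq_sqrt_inner_n: "L2_set x {1..n} = sqrt (inner_n n x x)"
  by (simp add: L2_set_def inner_n_def power2_eq_square)

lemma subspace_coord_space: "subspace (coord_space n)"
  by (auto simp: subspace_def coord_space_def)

lemma inner_n_span_eq_0:
  assumes "\<And>w. w \<in> S \<Longrightarrow> inner_n n z w = 0" "y \<in> span S"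
  shows "inner_n n z y = 0"
  using assms(2) by (induction rule: span_induct) (auto simp: subspace_def assms(1))

text \<open>
  Induction on the generating set: a new generator \<open>a\<close> is replaced by its residual \<open>c\<close> over the
  earlier span, and the projection is corrected along \<open>c\<close>.
\<close>

lemma orthogonal_projection:
  assumes "finite S"
  shows "\<exists>y\<in>span S. \<forall>w\<in>span S. inner_n n (x - y) w = 0"
proof -
  have "\<exists>y\<in>span S. \<forall>w\<in>S. inner_n n (x - y) w = 0" for x
    using assms
  proof (induction S arbitrary: x rule: finite_induct)
    case empty
    show ?case by (auto intro: span_zero)
  next
    case (insert a S)
    obtain b where b: "b \<in> span S" "\<And>w. w \<in> S \<Longrightarrow> inner_n n (a - b) w = 0"
      using insert.IH[of a] by blast
    obtain y where y: "y \<in> span S" "\<And>w. w \<in> S \<Longrightarrow> inner_n n (x - y) w = 0"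
      using insert.IH[of x] by blast
    define c where "c = a - b"
    define t where "t = inner_n n (x - y) c / inner_n n c c"
    let ?y = "y + t *\<^sub>R c"
    have a: "a = c + b" by (simp add: c_def)
    have S: "inner_n n (x - ?y) w = 0" if "w \<in> S" for w
      using b(2)[OF that] y(2)[OF that] by (simp add: c_def)
    have "inner_n n (x - ?y) c = inner_n n (x - y) c - t * inner_n n c c"
      by (simp add: algebra_simps)
    also have "\<dots> = 0"
      using inner_n_self_eq_0[of n c "x - y"] inner_n_commute[of n c "x - y"]
      by (cases "inner_n n c c = 0") (simp_all add: t_def)
    finally have "inner_n n (x - ?y) c = 0" .
    moreover have "inner_n n (x - ?y) b = 0"
      by (rule inner_n_span_eq_0[OF S b(1)])
    ultimately have "inner_n n (x - ?y) a = 0"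
      unfolding a by (simp only: inner_n_simps)
    moreover have "span S \<subseteq> span (insert a S)"
      by (rule span_mono) auto
    then have "?y \<in> span (insert a S)"
      unfolding c_def using b(1) y(1)
      by (intro span_add span_scale span_diff) (auto intro: span_base)
    ultimately show ?case
      using S by (intro bexI[of _ ?y] ballI) (auto simp del: inner_n_simps minus_apply plus_fun_apply scaleR_fun_apply)
  qed
  then show ?thesis
    by (meson inner_n_span_eq_0)
qed

text \<open>
  Fewer than \<open>n\<close> vectors cannot span all unit coordinate vectors; the residual of a missed one is
  the required normal vector.
\<close>

lemma orthogonal_vector_of_small_span:
  assumes "finite T" "card T < n" "T \<subseteq> coord_space n"
  shows "\<exists>e. inner_n n e e > 0 \<and> (\<forall>y\<in>span T. inner_n n e y = 0)"
proof -
  define \<delta> :: "nat \<Rightarrow> vec" where "\<delta> a = (\<lambda>b. if b = a then 1 else 0)" for a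
  have inj: "inj_on \<delta> {1..n}"
    by (auto simp: inj_on_def \<delta>_def fun_eq_iff)
  have "independent (\<delta> ` {1..n})"
    unfolding independent_explicit_finite_subsets
  proof (intro allI impI ballI)
    fix S u v assume S: "S \<subseteq> \<delta> ` {1..n}" "finite S" and 0: "(\<Sum>v\<in>S. u v *\<^sub>R v) = 0" and v: "v \<in> S"
    obtain a where a: "v = \<delta> a" using S v by auto
    have "0 = (\<Sum>v\<in>S. u v *\<^sub>R v) a" using 0 by simp
    also have "\<dots> = (\<Sum>x\<in>S. if x = v then u v else 0)"
      unfolding sum_fun_apply
    proof (intro sum.cong refl)
      fix x assume "x \<in> S"
      then obtain c where c: "x = \<delta> c" using S by auto
      have "\<delta> c = \<delta> a \<longleftrightarrow> c = a" by (auto simp: \<delta>_def fun_eq_iff)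
      then show "(u x *\<^sub>R x) a = (if x = v then u v else 0)"
        unfolding a c by (auto simp: \<delta>_def)
    qed
    also have "\<dots> = u v" using S v by simp
    finally show "u v = 0" by simp
  qed
  then have "\<not> \<delta> ` {1..n} \<subseteq> span T"
    using independent_span_bound[OF assms(1)] assms(2) card_image[OF inj] by fastforce
  then obtain a where a: "a \<in> {1..n}" "\<delta> a \<notin> span T" by blast
  obtain y where y: "y \<in> span T" "\<And>w. w \<in> span T \<Longrightarrow> inner_n n (\<delta> a - y) w = 0"
    using orthogonal_projection[OF assms(1), of n "\<delta> a"] by blast
  have "y \<in> coord_space n"
    using span_minimal[OF assms(3) subspace_coord_space] y(1) by auto
  moreover have "\<delta> a \<in> coord_space n"
    using a(1) by (auto simp: \<delta>_def coord_space_def)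
  ultimately have "\<delta> a - y \<in> coord_space n"
    by (intro subspace_diff subspace_coord_space)
  moreover have "\<delta> a - y \<noteq> 0" using a(2) y(1) by auto
  ultimately show ?thesis
    using y(2) inner_n_self_pos by blast
qed

text \<open>
  A family of \<open>n\<close> vectors fails to be independent either through a repetition or through a vector
  in the span of the others. In both cases fewer than \<open>n\<close> of the vectors span them all.
\<close>

lemma orthogonal_vector_of_dependent_family:
  assumes "finite I" "card I = n" "w ` I \<subseteq> coord_space n" "\<not> indep_family w I"
  shows "\<exists>e. inner_n n e e > 0 \<and> (\<forall>i\<in>I. inner_n n e (w i) = 0)"
proof -
  have "\<exists>T. finite T \<and> card T < n \<and> T \<subseteq> w ` I \<and> w ` I \<subseteq> span T"
  proof (cases "inj_on w I")
    case False
    then have "card (w ` I) < n"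
      using assms(1,2) by (metis card_image_le eq_card_imp_inj_on le_neq_implies_less)
    then show ?thesis
      using assms(1) by (intro exI[of _ "w ` I"]) (auto intro: span_base)
  next
    case True
    then obtain x where x: "x \<in> w ` I" "x \<in> span (w ` I - {x})"
      using assms(4) by (auto simp: indep_family_def dependent_def)
    then have "card (w ` I - {x}) < n"
      using True assms(1,2) by (metis card_Diff1_less card_image finite_imageI)
    moreover have "w ` I \<subseteq> span (w ` I - {x})"
      using x(2) by (auto intro: span_base)
    ultimately show ?thesis
      using assms(1) by (intro exI[of _ "w ` I - {x}"]) auto
  qed
  then obtain T where "finite T" "card T < n" "T \<subseteq> w ` I" "w ` I \<subseteq> span T" by auto
  with orthogonal_vector_of_small_span[of T n] assms(3) show ?thesis
    by (metis image_subset_iff subset_trans)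
qed

lemma residual_pos:
  assumes "finite I" "indep_family w I" "w ` I \<subseteq> coord_space n" "i \<in> I" "Q \<subseteq> I - {i}"
    "y \<in> span (w ` Q)"
  shows "inner_n n (w i - y) (w i - y) > 0"
proof -
  have "w ` Q \<subseteq> w ` I - {w i}"
    using assms(2,4,5) by (auto simp: indep_family_def inj_on_def)
  then have "y \<in> span (w ` I - {w i})"
    using assms(6) span_mono by blast
  moreover have "w i \<notin> span (w ` I - {w i})"
    using assms(2,4) by (auto simp: indep_family_def dependent_def)
  ultimately have "w i - y \<noteq> 0" by auto
  moreover have "span (w ` Q) \<subseteq> coord_space n"
    using assms(3,5) by (intro span_minimal subspace_coord_space) auto
  then have "w i - y \<in> coord_space n"
    using assms(3,4,6) by (intro subspace_diff subspace_coord_space) auto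
  ultimately show ?thesis by (intro inner_n_self_pos)
qed

text \<open>
  The dual vector of \<open>w i\<close> is the normalized residual of \<open>w i\<close> over the span of the other vectors.
\<close>

lemma dual_family:
  assumes "finite I" "indep_family w I" "w ` I \<subseteq> coord_space n"
  shows "\<exists>p. \<forall>i\<in>I. \<forall>j\<in>I. inner_n n (p i) (w j) = (if i = j then 1 else 0)"
proof -
  have "\<exists>q. \<forall>j\<in>I. inner_n n q (w j) = (if i = j then 1 else 0)" if i: "i \<in> I" for i
  proof -
    obtain y where y: "y \<in> span (w ` (I - {i}))" "\<And>z. z \<in> span (w ` (I - {i})) \<Longrightarrow> inner_n n (w i - y) z = 0"
      using orthogonal_projection[of "w ` (I - {i})" n "w i"] assms(1) by blast
    let ?z = "w i - y"
    have pos: "inner_n n ?z ?z > 0"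
      by (rule residual_pos[OF assms i subset_refl y(1)])
    have "inner_n n ?z (w i) = inner_n n ?z ?z + inner_n n ?z y"
      by (simp add: algebra_simps)
    then have "inner_n n ?z (w i) = inner_n n ?z ?z"
      using y by simp
    then have "\<forall>j\<in>I. inner_n n ((1 / inner_n n ?z ?z) *\<^sub>R ?z) (w j) = (if i = j then 1 else 0)"
      using pos y(2) by (auto intro!: span_base simp only: inner_n_simps(3)) (auto intro!: span_base)
    then show ?thesis by blast
  qed
  then show ?thesis by metis
qed

text \<open>
  The vector \<open>e i\<close> is the normalized residual of \<open>w i\<close> over the span of all \<open>w t\<close> with
  \<open>t \<in> I - J\<close> and of the earlier members of \<open>J\<close>, and \<open>d i\<close> is the length of that residual. Hence \<open>d i\<close> is at
  most the distance of \<open>w i\<close> from any smaller span: this is where distances to spans of the \<open>v\<^sub>i\<close>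
  alone can be used although the \<open>u\<^sub>i\<close> are present. Since \<open>e i\<close> combines only \<open>w i\<close> and its
  predecessors, it is orthogonal to the dual vectors of later indices.
\<close>

lemma partial_gram_schmidt:
  fixes w p :: "nat \<Rightarrow> vec"
  assumes I: "finite I" "indep_family w I" "w ` I \<subseteq> coord_space n" and J: "J \<subseteq> I"
    and dual': "\<forall>i\<in>I. \<forall>j\<in>I. inner_n n (p i) (w j) = (if i = j then 1 else 0)"
  shows "\<exists>e d. (\<forall>i\<in>J. \<forall>j\<in>J. inner_n n (e i) (e j) = (if i = j then 1 else 0)) \<and>
     (\<forall>l\<in>J. \<forall>i\<in>J. i < l \<longrightarrow> inner_n n (p l) (e i) = 0) \<and>
     (\<forall>i\<in>J. 0 < d i \<and> inner_n n (p i) (e i) = 1 / d i \<and>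
        (\<forall>Q \<subseteq> (I - J) \<union> {j\<in>J. j < i}. d i \<le> euclid_dist_set n (w i) (span (w ` Q))))"
proof -
  note dual = dual'[rule_format]
  define Q where "Q i = (I - J) \<union> {j\<in>J. j < i}" for i
  have "\<forall>i\<in>J. \<exists>y\<in>span (w ` Q i). \<forall>z\<in>span (w ` Q i). inner_n n (w i - y) z = 0"
    using I(1) J by (intro ballI orthogonal_projection) (auto simp: Q_def intro: finite_subset)
  then obtain y where y: "\<And>i. i \<in> J \<Longrightarrow> y i \<in> span (w ` Q i)"
      and orth: "\<And>i z. i \<in> J \<Longrightarrow> z \<in> span (w ` Q i) \<Longrightarrow> inner_n n (w i - y i) z = 0"
    by metis
  define d where "d i = sqrt (inner_n n (w i - y i) (w i - y i))" for i
  define e where "e i = (1 / d i) *\<^sub>R (w i - y i)" for i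
  have d: "d i > 0" if "i \<in> J" for i
    unfolding d_def using residual_pos[OF I _ _ y[OF that]] that J by (auto simp: Q_def)
  have less: "inner_n n (e j) (e i) = 0" if "i \<in> J" "j \<in> J" "i < j" for i j
  proof -
    have "w i \<in> span (w ` Q j)" using that by (auto simp: Q_def intro!: span_base)
    moreover have "span (w ` Q i) \<subseteq> span (w ` Q j)"
      using that by (intro span_mono) (auto simp: Q_def)
    ultimately have "w i - y i \<in> span (w ` Q j)"
      using y[OF that(1)] by (intro span_diff) auto
    from orth[OF that(2) this] show ?thesis
      unfolding e_def inner_n_simps(3,8) by simp
  qed
  have self: "inner_n n (e i) (e i) = 1" if "i \<in> J" for i
  proof -
    have "inner_n n (w i - y i) (w i - y i) = d i * d i"
      using inner_n_self_nonneg[of n "w i - y i"] by (simp add: d_def del: inner_n_simps)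
    then show ?thesis
      using d[OF that] unfolding e_def inner_n_simps(3,8) by simp
  qed
  have "inner_n n (e i) (e j) = (if i = j then 1 else 0)" if "i \<in> J" "j \<in> J" for i j
    using less[of i j] less[of j i] self[of i] that by (auto simp: inner_n_commute neq_iff)
  moreover have pQ: "inner_n n (p l) (y i) = 0" if l: "l \<in> J" "i \<in> J" "i \<le> l" for l i
  proof (rule inner_n_span_eq_0[OF _ y[OF l(2)]])
    fix x assume "x \<in> w ` Q i"
    then obtain t where "x = w t" "t \<in> I" "t \<noteq> l"
      using l J by (auto simp: Q_def)
    then show "inner_n n (p l) x = 0"
      using dual[of l t] l J by auto
  qed
  then have "inner_n n (p l) (e i) = 0" if "l \<in> J" "i \<in> J" "i < l" for l i
    using that J dual[of l i] by (auto simp: e_def)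
  moreover have "inner_n n (p i) (e i) = 1 / d i" if "i \<in> J" for i
    using that J dual[of i i] pQ[of i i] by (auto simp: e_def)
  moreover have "d i \<le> euclid_dist_set n (w i) (span (w ` R))" if i: "i \<in> J" and R: "R \<subseteq> (I - J) \<union> {j\<in>J. j < i}" for i R
    unfolding euclid_dist_set_def
  proof (rule cINF_greatest)
    show "span (w ` R) \<noteq> {}" by (auto intro: span_zero)
    fix x assume "x \<in> span (w ` R)"
    moreover have "span (w ` R) \<subseteq> span (w ` Q i)" using R by (intro span_mono) (auto simp: Q_def)
    ultimately have x: "y i - x \<in> span (w ` Q i)" using y[OF i] by (intro span_diff) auto
    have eq: "w i - x = (w i - y i) + (y i - x)" by simp
    have "inner_n n (w i - x) (w i - x) =
        inner_n n (w i - y i) (w i - y i) + 2 * inner_n n (w i - y i) (y i - x) + inner_n n (y i - x) (y i - x)"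
      unfolding eq by (simp add: inner_n_commute algebra_simps)
    then have "inner_n n (w i - y i) (w i - y i) \<le> inner_n n (w i - x) (w i - x)"
      using orth[OF i x] inner_n_self_nonneg[of n "y i - x"] by simp
    then show "d i \<le> L2_set (\<lambda>a. w i a - x a) {1..n}"
      using L2_set_eq_sqrt_inner_n[of "w i - x" n] by (simp add: d_def fun_diff_def)
  qed
  ultimately show ?thesis
    using d by (intro exI[of _ e] exI[of _ d]) blast
qed

text \<open>
  The combinations with coefficients of \<open>\<ell>\<^sub>1\<close>-norm at most one form a convex set containing all \<open>\<plusminus> w i\<close>.
\<close>

lemma cross_polytope_coefficients:
  assumes "finite I" "x \<in> convex hull (\<Union>i\<in>I. {w i, - w i :: 'a::real_vector})"
  shows "\<exists>b. x = (\<Sum>i\<in>I. b i *\<^sub>R w i) \<and> (\<Sum>i\<in>I. \<bar>b i\<bar>) \<le> 1"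
proof -
  let ?S = "{x. \<exists>b. x = (\<Sum>i\<in>I. b i *\<^sub>R w i) \<and> (\<Sum>i\<in>I. \<bar>b i\<bar>) \<le> 1}"
  have "convex ?S"
    unfolding convex_def
  proof (intro ballI allI impI)
    fix x y and u v :: real assume "x \<in> ?S" "y \<in> ?S" and uv: "0 \<le> u" "0 \<le> v" "u + v = 1"
    then obtain b c where b: "x = (\<Sum>i\<in>I. b i *\<^sub>R w i)" "(\<Sum>i\<in>I. \<bar>b i\<bar>) \<le> 1"
      and c: "y = (\<Sum>i\<in>I. c i *\<^sub>R w i)" "(\<Sum>i\<in>I. \<bar>c i\<bar>) \<le> 1" by auto
    have "(\<Sum>i\<in>I. \<bar>u * b i + v * c i\<bar>) \<le> (\<Sum>i\<in>I. u * \<bar>b i\<bar> + v * \<bar>c i\<bar>)"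
      using uv by (intro sum_mono) (metis abs_mult abs_of_nonneg abs_triangle_ineq)
    also have "\<dots> \<le> u * 1 + v * 1"
      unfolding sum.distrib sum_distrib_left[symmetric] using uv b c by (intro add_mono mult_left_mono) auto
    finally have "(\<Sum>i\<in>I. \<bar>u * b i + v * c i\<bar>) \<le> 1" using uv by simp
    moreover have "u *\<^sub>R x + v *\<^sub>R y = (\<Sum>i\<in>I. (u * b i + v * c i) *\<^sub>R w i)"
      by (simp add: b c scaleR_sum_right sum.distrib scaleR_add_left)
    ultimately show "u *\<^sub>R x + v *\<^sub>R y \<in> ?S" by auto
  qed
  moreover have "(\<Union>i\<in>I. {w i, - w i}) \<subseteq> ?S"
  proof safe
    fix i assume i: "i \<in> I"
    have "w i = (\<Sum>j\<in>I. (if j = i then 1 else 0) *\<^sub>R w j)"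
      "(\<Sum>j\<in>I. \<bar>if j = i then 1 else 0 :: real\<bar>) \<le> 1"
      using i assms(1) by (simp_all add: if_distrib[of "\<lambda>c. c *\<^sub>R _"] if_distrib[of abs] cong: if_cong)
    then show "\<exists>b. w i = (\<Sum>i\<in>I. b i *\<^sub>R w i) \<and> (\<Sum>i\<in>I. \<bar>b i\<bar>) \<le> 1"
      by (intro exI[of _ "\<lambda>j. if j = i then 1 else 0"] conjI)
    have "- w i = (\<Sum>j\<in>I. (if j = i then - 1 else 0) *\<^sub>R w j)"
      "(\<Sum>j\<in>I. \<bar>if j = i then - 1 else 0 :: real\<bar>) \<le> 1"
      using i assms(1) by (simp_all add: if_distrib[of "\<lambda>c. c *\<^sub>R _"] if_distrib[of abs] cong: if_cong)
    then show "\<exists>b. - w i = (\<Sum>i\<in>I. b i *\<^sub>R w i) \<and> (\<Sum>i\<in>I. \<bar>b i\<bar>) \<le> 1"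
      by (intro exI[of _ "\<lambda>j. if j = i then - 1 else 0"] conjI)
  qed
  ultimately have "convex hull (\<Union>i\<in>I. {w i, - w i}) \<subseteq> ?S"
    by (intro hull_minimal) auto
  with assms(2) show ?thesis by auto
qed

section \<open>Averages over subsets and the reordered index set\<close>

lemma card_subsets_containing:
  assumes "finite A" "j \<in> A" "1 \<le> r"
  shows "card {J. J \<subseteq> A \<and> card J = r \<and> j \<in> J} = (card A - 1) choose (r - 1)"
proof -
  have "bij_betw (insert j) {B. B \<subseteq> A - {j} \<and> card B = r - 1} {J. J \<subseteq> A \<and> card J = r \<and> j \<in> J}"
  proof (rule bij_betw_byWitness[where f' = "\<lambda>J. J - {j}"])
    show "insert j ` {B. B \<subseteq> A - {j} \<and> card B = r - 1} \<subseteq> {J. J \<subseteq> A \<and> card J = r \<and> j \<in> J}"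
    proof (rule image_subsetI)
      fix B assume "B \<in> {B. B \<subseteq> A - {j} \<and> card B = r - 1}"
      then have B: "B \<subseteq> A - {j}" "card B = r - 1" by auto
      then have "finite B" "j \<notin> B" using assms(1) by (auto intro: finite_subset)
      then show "insert j B \<in> {J. J \<subseteq> A \<and> card J = r \<and> j \<in> J}" using B assms(2,3) by auto
    qed
    show "(\<lambda>J. J - {j}) ` {J. J \<subseteq> A \<and> card J = r \<and> j \<in> J} \<subseteq> {B. B \<subseteq> A - {j} \<and> card B = r - 1}"
      by auto
  qed auto
  then have "card {J. J \<subseteq> A \<and> card J = r \<and> j \<in> J} = card {B. B \<subseteq> A - {j} \<and> card B = r - 1}"
    by (simp add: bij_betw_same_card)
  also have "\<dots> = card (A - {j}) choose (r - 1)"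
    using assms(1) by (intro n_subsets) auto
  finally show ?thesis using assms(1,2) by simp
qed

text \<open>
  Double counting: every element lies in \<open>(card A - 1) choose (r - 1)\<close> of the subsets.
\<close>

lemma sum_over_subsets_of_card:
  fixes y :: "'a \<Rightarrow> real"
  assumes "finite A" "1 \<le> r"
  shows "real (card A) * (\<Sum>J | J \<subseteq> A \<and> card J = r. sum y J) = real r * real (card A choose r) * sum y A"
proof -
  let ?F = "{J. J \<subseteq> A \<and> card J = r}"
  have fin: "finite ?F" using assms(1) by auto
  have "(\<Sum>J\<in>?F. sum y J) = (\<Sum>J\<in>?F. \<Sum>j\<in>A. if j \<in> J then y j else 0)"
  proof (rule sum.cong[OF refl])
    fix J assume "J \<in> ?F"
    then have "A \<inter> J = J" by auto
    then show "sum y J = (\<Sum>j\<in>A. if j \<in> J then y j else 0)"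
      using sum.inter_restrict[OF assms(1), of y J] by simp
  qed
  also have "\<dots> = (\<Sum>j\<in>A. \<Sum>J\<in>?F. if j \<in> J then y j else 0)"
    by (rule sum.swap)
  also have "\<dots> = (\<Sum>j\<in>A. real ((card A - 1) choose (r - 1)) * y j)"
  proof (rule sum.cong[OF refl])
    fix j assume j: "j \<in> A"
    have "(\<Sum>J\<in>?F. if j \<in> J then y j else 0) = (\<Sum>J\<in>{J \<in> ?F. j \<in> J}. y j)"
      using fin by (subst sum.inter_filter) auto
    also have "{J \<in> ?F. j \<in> J} = {J. J \<subseteq> A \<and> card J = r \<and> j \<in> J}" by auto
    finally show "(\<Sum>J\<in>?F. if j \<in> J then y j else 0) = real ((card A - 1) choose (r - 1)) * y j"
      by (simp add: card_subsets_containing[OF assms(1) j assms(2)])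
  qed
  also have "\<dots> = real ((card A - 1) choose (r - 1)) * sum y A"
    by (simp add: sum_distrib_left)
  finally have "real (card A) * (\<Sum>J\<in>?F. sum y J) = real (card A * ((card A - 1) choose (r - 1))) * sum y A"
    by simp
  also have "card A * ((card A - 1) choose (r - 1)) = r * (card A choose r)"
    using times_binomial_minus1_eq[of r "card A"] assms(2) by simp
  finally show ?thesis by simp
qed

text \<open>
  Jensen's inequality for the exponential function, obtained from its tangent line at the average
  value of \<open>- sum y J\<close>. It is stated without the normalizing division by the number of subsets.
\<close>

lemma subset_average_exp_ge:
  fixes y :: "'a \<Rightarrow> real"
  assumes "finite A" "1 \<le> r" "r \<le> card A" "sum y A \<le> M"
  shows "real (card A choose r) * exp (- (real r * M / real (card A)))
    \<le> (\<Sum>J | J \<subseteq> A \<and> card J = r. exp (- sum y J))"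
proof -
  let ?F = "{J. J \<subseteq> A \<and> card J = r}"
  let ?N = "real (card A choose r)" and ?m = "real r * M / real (card A)"
  have A: "real (card A) > 0" using assms by simp
  have card: "card ?F = card A choose r" by (rule n_subsets[OF assms(1)])
  have "real (card A) * (\<Sum>J\<in>?F. sum y J) \<le> real r * ?N * M"
    unfolding sum_over_subsets_of_card[OF assms(1,2)] using assms(4) by (intro mult_left_mono) auto
  then have le: "(\<Sum>J\<in>?F. sum y J) \<le> ?N * ?m"
    using A by (simp add: field_simps)
  have "?N * exp (- ?m) \<le> exp (- ?m) * (?N + ?N * ?m - (\<Sum>J\<in>?F. sum y J))"
    using le by simp
  also have "\<dots> = (\<Sum>J\<in>?F. exp (- ?m) * (1 + (?m - sum y J)))"
    by (simp add: sum_distrib_left[symmetric] sum.distrib sum_subtractf card)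
  also have "\<dots> \<le> (\<Sum>J\<in>?F. exp (- sum y J))"
  proof (rule sum_mono)
    fix J
    have "exp (- ?m) * (1 + (?m - sum y J)) \<le> exp (- ?m) * exp (?m - sum y J)"
      by (intro mult_left_mono exp_ge_add_one_self) auto
    also have "\<dots> = exp (- sum y J)" by (simp add: exp_add[symmetric])
    finally show "exp (- ?m) * (1 + (?m - sum y J)) \<le> exp (- sum y J)" .
  qed
  finally show ?thesis .
qed

text \<open>
  The last \<open>r\<close> positions of the reordering enumerate \<open>J\<close> increasingly, so what precedes the position
  of \<open>j \<in> J\<close> is exactly \<open>I1 - J\<close> together with the smaller elements of \<open>J\<close>. This translates the
  condition on positions into one on elements.
\<close>

lemma card_sigma_ord_le:
  fixes v :: "nat \<Rightarrow> vec"
  assumes "finite I1" "J \<subseteq> I1" "card I1 = N" "card J = r"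
  shows "card {l \<in> {N - r + 1..N}.
      euclid_dist_set n (v (sigma_ord I1 J l)) (span {v (sigma_ord I1 J t) |t. 1 \<le> t \<and> t < l}) \<le> D}
    \<le> card {j \<in> J. euclid_dist_set n (v j) (span (v ` ((I1 - J) \<union> {i \<in> J. i < j}))) \<le> D}"
    (is "card ?L \<le> card ?R")
proof (rule card_inj_on_le[where f = "sigma_ord I1 J"])
  have finJ: "finite J" using assms by (auto intro: finite_subset)
  define xs where "xs = sorted_list_of_set (I1 - J)"
  define ys where "ys = sorted_list_of_set J"
  have len: "length xs = N - r" "length ys = r"
    using assms finJ by (simp_all add: xs_def ys_def card_Diff_subset)
  have rN: "r \<le> N" using assms card_mono by metis
  have set: "set xs = I1 - J" "set ys = J"
    using assms finJ by (simp_all add: xs_def ys_def)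
  have dist: "distinct ys" by (simp add: ys_def)
  have sorted: "sorted_wrt (<) ys" by (simp add: ys_def)
  have sig: "sigma_ord I1 J l = ys ! (l - 1 - (N - r))" if "l \<in> {N - r + 1..N}" for l
    using that len by (auto simp: sigma_ord_def xs_def[symmetric] ys_def[symmetric] nth_append)
  have prev: "sigma_ord I1 J ` {t. 1 \<le> t \<and> t < l} = (I1 - J) \<union> {i \<in> J. i < sigma_ord I1 J l}"
    if l: "l \<in> {N - r + 1..N}" for l
  proof -
    define q where "q = l - 1 - (N - r)"
    have q: "q < r" "l - 1 = N - r + q" using l rN by (auto simp: q_def)
    have "sigma_ord I1 J ` {t. 1 \<le> t \<and> t < l} = (!) (xs @ ys) ` ((\<lambda>t. t - 1) ` {t. 1 \<le> t \<and> t < l})"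
      by (auto simp: sigma_ord_def xs_def ys_def image_image)
    also have "(\<lambda>t. t - 1) ` {t. 1 \<le> t \<and> t < l} = {..<l - 1}"
    proof (intro equalityI subsetI)
      fix x assume "x \<in> {..<l - 1}"
      then show "x \<in> (\<lambda>t. t - 1) ` {t. 1 \<le> t \<and> t < l}"
        by (intro image_eqI[of _ _ "Suc x"]) auto
    qed auto
    also have "(!) (xs @ ys) ` {..<l - 1} = set (take (l - 1) (xs @ ys))"
      using l len rN by (subst nth_image[symmetric]) (auto simp: atLeast0LessThan)
    also have "\<dots> = set xs \<union> set (take q ys)"
      using q len by simp
    also have "set (take q ys) = {i \<in> J. i < ys ! q}"
    proof (intro equalityI subsetI)
      fix i assume "i \<in> set (take q ys)"
      then obtain k where "k < q" "i = ys ! k"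
        using q len by (auto simp: in_set_conv_nth)
      then show "i \<in> {i \<in> J. i < ys ! q}"
        using sorted_wrt_nth_less[OF sorted, of k q] q len set by auto
    next
      fix i assume "i \<in> {i \<in> J. i < ys ! q}"
      then obtain k where k: "k < r" "i = ys ! k" "ys ! k < ys ! q"
        using set len by (auto simp: in_set_conv_nth)
      have "k < q"
      proof (rule ccontr)
        assume "\<not> k < q"
        then have "ys ! q \<le> ys ! k"
          using sorted_wrt_nth_less[OF sorted, of q k] k len by (cases "k = q") auto
        with k show False by simp
      qed
      then show "i \<in> set (take q ys)"
        using k q len by (auto simp: in_set_conv_nth)
    qed
    finally show ?thesis
      using sig[OF l] set by (simp add: q_def)
  qed
  show "inj_on (sigma_ord I1 J) ?L"
  proof (rule inj_onI)
    fix l t assume "l \<in> ?L" "t \<in> ?L" "sigma_ord I1 J l = sigma_ord I1 J t"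
    then have lt: "l \<in> {N - r + 1..N}" "t \<in> {N - r + 1..N}"
      and "ys ! (l - 1 - (N - r)) = ys ! (t - 1 - (N - r))"
      using sig[of l] sig[of t] by auto
    then have "l - 1 - (N - r) = t - 1 - (N - r)"
      using dist len rN by (subst (asm) nth_eq_iff_index_eq) auto
    then show "l = t" using lt by auto
  qed
  show "sigma_ord I1 J ` ?L \<subseteq> ?R"
  proof safe
    fix l assume l: "l \<in> {N - r + 1..N}" and
      d: "euclid_dist_set n (v (sigma_ord I1 J l)) (span {v (sigma_ord I1 J t) |t. 1 \<le> t \<and> t < l}) \<le> D"
    show "sigma_ord I1 J l \<in> J"
      using sig[OF l] set len l rN by auto
    have "{v (sigma_ord I1 J t) |t. 1 \<le> t \<and> t < l} = v ` (sigma_ord I1 J ` {t. 1 \<le> t \<and> t < l})"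
      by auto
    with d show "euclid_dist_set n (v (sigma_ord I1 J l))
        (span (v ` ((I1 - J) \<union> {i \<in> J. i < sigma_ord I1 J l}))) \<le> D"
      by (simp only: prev[OF l])
  qed
  show "finite ?R" using finJ by simp
qed

section \<open>Integrable majorants of sets\<close>

text \<open>
  An upper bound for an outer Gaussian measure, witnessed by a function. It is subadditive over unions
  of arbitrary sets, so that measurability of the polytopes never has to be established. The point \<open>x\<close>
  of the product space is compared with \<open>y \<in> B\<close> on \<open>{1..n}\<close> only, because outside this set \<open>x\<close> is
  undefined while \<open>y\<close> vanishes.
\<close>

definition has_majorant :: "nat \<Rightarrow> vec set \<Rightarrow> real \<Rightarrow> bool"
  where "has_majorant n B \<delta> \<longleftrightarrow>
    (\<exists>F \<in> borel_measurable (\<Pi>\<^sub>M a\<in>{1..n}. std_gauss). (\<forall>x. 0 \<le> F x) \<and>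
       (\<forall>x. \<forall>y\<in>B. (\<forall>a\<in>{1..n}. x a = y a) \<longrightarrow> 1 \<le> F x) \<and>
       (\<integral>\<^sup>+x. ennreal (F x) \<partial>(\<Pi>\<^sub>M a\<in>{1..n}. std_gauss)) \<le> ennreal \<delta>)"

lemma has_majorant_UN:
  assumes "finite T" "\<And>i. i \<in> T \<Longrightarrow> has_majorant n (B i) \<delta>" "0 \<le> \<delta>"
  shows "has_majorant n (\<Union>i\<in>T. B i) (real (card T) * \<delta>)"
proof -
  obtain F where F: "\<And>i. i \<in> T \<Longrightarrow> F i \<in> borel_measurable (\<Pi>\<^sub>M a\<in>{1..n}. std_gauss)"
      "\<And>i x. i \<in> T \<Longrightarrow> 0 \<le> F i x"
      "\<And>i x y. i \<in> T \<Longrightarrow> y \<in> B i \<Longrightarrow> \<forall>a\<in>{1..n}. x a = y a \<Longrightarrow> 1 \<le> F i x"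
      "\<And>i. i \<in> T \<Longrightarrow> (\<integral>\<^sup>+x. ennreal (F i x) \<partial>(\<Pi>\<^sub>M a\<in>{1..n}. std_gauss)) \<le> ennreal \<delta>"
    using assms(2) unfolding has_majorant_def by metis
  show ?thesis
    unfolding has_majorant_def
  proof (intro bexI[of _ "\<lambda>x. \<Sum>i\<in>T. F i x"] conjI allI ballI impI)
    show "0 \<le> (\<Sum>i\<in>T. F i x)" for x
      using F(2) by (intro sum_nonneg)
    show "1 \<le> (\<Sum>i\<in>T. F i x)" if y: "y \<in> (\<Union>i\<in>T. B i)" and xy: "\<forall>a\<in>{1..n}. x a = y a" for x y
    proof -
      obtain i where i: "i \<in> T" "y \<in> B i" using y by auto
      then have "1 \<le> F i x" using F(3) xy by blast
      also have "\<dots> \<le> (\<Sum>i\<in>T. F i x)"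
        using assms(1) i F(2) by (intro member_le_sum) auto
      finally show ?thesis .
    qed
    have "(\<integral>\<^sup>+x. ennreal (\<Sum>i\<in>T. F i x) \<partial>(\<Pi>\<^sub>M a\<in>{1..n}. std_gauss))
        = (\<integral>\<^sup>+x. (\<Sum>i\<in>T. ennreal (F i x)) \<partial>(\<Pi>\<^sub>M a\<in>{1..n}. std_gauss))"
      using F(2) by (simp add: sum_ennreal)
    also have "\<dots> = (\<Sum>i\<in>T. \<integral>\<^sup>+x. ennreal (F i x) \<partial>(\<Pi>\<^sub>M a\<in>{1..n}. std_gauss))"
      using F(1) by (intro nn_integral_sum) auto
    also have "\<dots> \<le> (\<Sum>i\<in>T. ennreal \<delta>)"
      by (intro sum_mono F(4))
    also have "\<dots> = ennreal (real (card T) * \<delta>)"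
      using assms(3) by (simp add: ennreal_mult ennreal_of_nat_eq_real_of_nat)
    finally show "(\<integral>\<^sup>+x. ennreal (\<Sum>i\<in>T. F i x) \<partial>(\<Pi>\<^sub>M a\<in>{1..n}. std_gauss)) \<le> ennreal (real (card T) * \<delta>)" .
    show "(\<lambda>x. \<Sum>i\<in>T. F i x) \<in> borel_measurable (\<Pi>\<^sub>M a\<in>{1..n}. std_gauss)"
      using F(1) by (intro borel_measurable_sum)
  qed
qed

text \<open>
  Markov's inequality; a set outside the sigma-algebra has measure zero by convention.
\<close>

lemma gauss_measure_le_of_majorant:
  assumes "has_majorant n B \<delta>" "0 \<le> \<delta>"
  shows "gauss_measure n B \<le> \<delta>"
proof -
  let ?G = "\<Pi>\<^sub>M a\<in>{1..n}. std_gauss"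
  interpret S: real_distribution std_gauss by (rule real_distribution_std_gauss)
  interpret prob_space ?G by (rule S.prob_space_PiM_const)
  let ?S = "{x \<in> space ?G. (\<lambda>a. if a \<in> {1..n} then x a else 0) \<in> B}"
  obtain F where F: "F \<in> borel_measurable ?G" "\<And>x. 0 \<le> F x"
      "\<And>x y. y \<in> B \<Longrightarrow> \<forall>a\<in>{1..n}. x a = y a \<Longrightarrow> 1 \<le> F x"
      "(\<integral>\<^sup>+x. ennreal (F x) \<partial>?G) \<le> ennreal \<delta>"
    using assms(1) unfolding has_majorant_def by metis
  have "measure ?G ?S \<le> \<delta>"
  proof (cases "?S \<in> sets ?G")
    case True
    have "emeasure ?G ?S = (\<integral>\<^sup>+x. indicator ?S x \<partial>?G)"
      using True by simp
    also have "\<dots> \<le> (\<integral>\<^sup>+x. ennreal (F x) \<partial>?G)"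
    proof (rule nn_integral_mono)
      fix x
      have "1 \<le> F x" if "x \<in> ?S"
        using that by (intro F(3)[of "\<lambda>a. if a \<in> {1..n} then x a else 0"]) auto
      then show "indicator ?S x \<le> ennreal (F x)"
        by (auto simp: indicator_def)
    qed
    also note F(4)
    finally show ?thesis
      using assms(2) by (simp add: measure_def enn2real_leI)
  qed (simp add: measure_notin_sets assms(2))
  then show ?thesis by (simp add: gauss_measure_def Let_def)
qed

section \<open>Gaussian measure of a cross-polytope with short vectors\<close>

text \<open>
  The cubic Taylor polynomial suffices, because \<open>b\<^sup>2/6 - b/2 + 1\<close> has negative discriminant.
\<close>

lemma one_plus_square_le_exp_abs: "1 + y\<^sup>2 \<le> exp \<bar>y :: real\<bar>"
proof -
  define b where "b = \<bar>y\<bar>"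
  have b: "b \<ge> 0" by (simp add: b_def)
  have "(\<lambda>i. b ^ i /\<^sub>R fact i) sums exp b" by (rule exp_converges)
  then have "(\<Sum>i<4. b ^ i /\<^sub>R fact i) \<le> exp b"
    using sum_le_suminf[of "\<lambda>i. b ^ i /\<^sub>R fact i" "{..<4}"] b by (simp add: sums_iff)
  moreover have four: "{..<4::nat} = {0, 1, 2, 3}" by auto
  ultimately have "1 + b + b\<^sup>2 / 2 + b ^ 3 / 6 \<le> exp b"
    unfolding four by (simp add: fact_numeral)
  moreover have "0 \<le> b * ((b - 3 / 2)\<^sup>2 + 15 / 4) / 6"
    using b by (intro divide_nonneg_pos mult_nonneg_nonneg) auto
  then have "b\<^sup>2 / 2 \<le> b + b ^ 3 / 6"
    by (simp add: power2_eq_square power3_eq_cube field_simps)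
  moreover have "y\<^sup>2 = b\<^sup>2" by (simp add: b_def)
  ultimately show ?thesis unfolding b_def[symmetric] by linarith
qed

lemma sqrt_2_pi_le: "sqrt (2 * pi) \<le> 4"
  by (rule real_le_lsqrt) (use pi_less_4 in auto)

text \<open>
  A set contained in a hyperplane has arbitrarily small majorants \<open>1/(1 + (\<theta>\<langle>e, x\<rangle>)\<^sup>2)\<close>: they
  equal one on the hyperplane and have expectation of order \<open>1/\<theta>\<close>.
\<close>

lemma has_majorant_dependent:
  assumes "inner_n n e e > 0" "\<And>y. y \<in> B \<Longrightarrow> inner_n n e y = 0" "0 < \<delta>"
  shows "has_majorant n B \<delta>"
proof -
  interpret S: real_distribution std_gauss by (rule real_distribution_std_gauss)
  have sets [measurable_cong]: "sets std_gauss = sets borel" by simp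
  define s where "s = sqrt (inner_n n e e)"
  \<comment> \<open>Chosen so that \<open>sqrt (2 * pi) / (2 * \<theta> * s) \<le> \<delta>\<close>.\<close>
  define \<theta> where "\<theta> = 2 / (\<delta> * s)"
  have s: "s > 0" "s * s = inner_n n e e" using assms(1) by (simp_all add: s_def)
  have \<theta>: "\<theta> > 0" using s assms(3) by (simp add: \<theta>_def)
  have lin: "(\<Sum>a\<in>{1..n}. (\<theta> * e a) * x a) = \<theta> * inner_n n e x" for x
    by (simp add: inner_n_def sum_distrib_left mult_ac)
  show ?thesis
    unfolding has_majorant_def
  proof (intro bexI[of _ "\<lambda>x. 1 / (1 + (\<Sum>a\<in>{1..n}. (\<theta> * e a) * x a)\<^sup>2)"] conjI allI ballI impI)
    fix x y assume "y \<in> B" "\<forall>a\<in>{1..n}. x a = y a"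
    then have "inner_n n e x = 0"
      using assms(2) inner_n_cong[of n x y e] by simp
    then show "1 \<le> 1 / (1 + (\<Sum>a\<in>{1..n}. (\<theta> * e a) * x a)\<^sup>2)"
      unfolding lin by simp
  next
    have unit: "(\<Sum>a\<in>{1..n}. (e a / s) * (e a / s)) = 1"
    proof -
      have "(\<Sum>a\<in>{1..n}. (e a / s) * (e a / s)) = inner_n n e e / (s * s)"
        by (simp add: inner_n_def sum_divide_distrib)
      then show ?thesis using s assms(1) by simp
    qed
    have val: "(\<Sum>a\<in>{1..n}. (\<theta> * e a) * (e a / s)) = \<theta> * s"
    proof -
      have "(\<Sum>a\<in>{1..n}. (\<theta> * e a) * (e a / s)) = \<theta> * inner_n n e e / s"
        by (simp add: inner_n_def sum_divide_distrib sum_distrib_left mult_ac)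
      also have "\<dots> = \<theta> * s" using s(1) by (simp add: s(2)[symmetric])
      finally show ?thesis .
    qed
    have "(\<integral>\<^sup>+x. ennreal (\<Prod>l\<in>{0::nat}. 1 / (1 + (\<Sum>a\<in>{1..n}. (\<theta> * e a) * x a)\<^sup>2)) \<partial>(\<Pi>\<^sub>M a\<in>{1..n}. std_gauss))
      \<le> (\<Prod>i\<in>{0::nat}. ennreal (sqrt (2 * pi) / (2 * (\<Sum>a\<in>{1..n}. (\<theta> * e a) * (e a / s)))))"
      using unit val \<theta> s by (intro gauss_cauchy_product_le) auto
    also have "\<dots> \<le> ennreal \<delta>"
    proof -
      have "sqrt (2 * pi) / (2 * (\<theta> * s)) = \<delta> * (sqrt (2 * pi) / 4)"
        using s assms(3) by (simp add: \<theta>_def)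
      also have "\<dots> \<le> \<delta> * 1"
        using assms(3) sqrt_2_pi_le by (intro mult_left_mono) auto
      finally show ?thesis unfolding val by (simp add: ennreal_leI)
    qed
    finally show "(\<integral>\<^sup>+x. ennreal (1 / (1 + (\<Sum>a\<in>{1..n}. (\<theta> * e a) * x a)\<^sup>2)) \<partial>(\<Pi>\<^sub>M a\<in>{1..n}. std_gauss)) \<le> ennreal \<delta>"
      by simp
  qed auto
qed

text \<open>
  The majorant is \<open>exp (r \<theta> R / N)\<close> times the average over all \<open>J \<subseteq> K\<close> of size \<open>r\<close> of
  \<open>\<Prod>\<^sub>l 1/(1 + (\<theta>\<langle>p\<^sub>l, x\<rangle>)\<^sup>2)\<close>, where \<open>N = card K\<close> and \<open>l\<close> ranges over the indices \<open>H J\<close> in \<open>J\<close> of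
  vectors close to the span of their predecessors.
  On the polytope the average is at least \<open>exp (- r \<theta> R / N)\<close>, by \<open>1/(1 + b\<^sup>2) \<ge> exp (- \<bar>b\<bar>)\<close> and
  Jensen's inequality. In expectation every factor contributes at most \<open>exp (- 4)\<close> by the choice
  \<open>\<theta> = 2e\<^sup>4D\<close>, and there are at least \<open>r/2\<close> factors; this gains \<open>exp (- 2r)\<close>, of which the
  normalization \<open>exp (r \<theta> R / N) \<le> exp r\<close> uses up half.
\<close>

lemma has_majorant_independent:
  fixes w :: "nat \<Rightarrow> vec"
  assumes I: "finite I" "indep_family w I" "w ` I \<subseteq> coord_space n" "K \<subseteq> I"
    and r: "1 \<le> r" "r \<le> card K" and D: "0 < D" and R: "0 \<le> R"
    and short: "\<And>J. J \<subseteq> K \<Longrightarrow> card J = r \<Longrightarrow> real r / 2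
      \<le> real (card {j \<in> J. euclid_dist_set n (w j) (span (w ` ((K - J) \<union> {i \<in> J. i < j}))) \<le> D})"
    and small: "2 * exp 4 * D * R \<le> real (card K)"
  shows "has_majorant n ((\<lambda>x. R *\<^sub>R x) ` (convex hull (\<Union>i\<in>I. {w i, - w i}))) (exp (- real r))"
proof -
  interpret S: real_distribution std_gauss by (rule real_distribution_std_gauss)
  have sets [measurable_cong]: "sets std_gauss = sets borel" by simp
  note One_nat_def [simp del]
  let ?G = "\<Pi>\<^sub>M a\<in>{1..n}. std_gauss"
  define \<theta> where "\<theta> = 2 * exp 4 * D"
  define N where "N = real (card K)"
  define \<J> where "\<J> = {J. J \<subseteq> K \<and> card J = r}"
  define C where "C = real (card K choose r)"
  define c where "c = exp (real r * (\<theta> * R) / N) / C"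
  define H where "H J = {j \<in> J. euclid_dist_set n (w j) (span (w ` ((K - J) \<union> {i \<in> J. i < j}))) \<le> D}" for J
  have \<theta>: "\<theta> > 0" using D by (simp add: \<theta>_def)
  have N: "N > 0" using r by (simp add: N_def)
  have finI1: "finite K" using I by (auto intro: finite_subset)
  have C: "C > 0" using r by (simp add: C_def)
  have c: "c > 0" using C by (simp add: c_def)
  have cardJ: "card \<J> = card K choose r" unfolding \<J>_def by (rule n_subsets[OF finI1])
  obtain p where dual': "\<forall>i\<in>I. \<forall>j\<in>I. inner_n n (p i) (w j) = (if i = j then 1 else 0)"
    using dual_family[OF I(1-3)] by blast
  note dual = dual'[rule_format]
  define g where "g J x = (\<Prod>l\<in>H J. 1 / (1 + (\<Sum>a\<in>{1..n}. (\<theta> * p l a) * x a)\<^sup>2))" for J x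
  have g0: "0 \<le> g J x" for J x
    unfolding g_def by (intro prod_nonneg) (auto simp: add_nonneg_nonneg)
  have g_meas [measurable]: "g J \<in> borel_measurable ?G" for J
    unfolding g_def by measurable
  have lin: "(\<Sum>a\<in>{1..n}. (\<theta> * p l a) * x a) = \<theta> * inner_n n (p l) x" for l x
    by (simp add: inner_n_def sum_distrib_left mult_ac)
  have g_int: "(\<integral>\<^sup>+x. ennreal (g J x) \<partial>?G) \<le> ennreal (exp (- 2 * real r))" if J: "J \<in> \<J>" for J
  proof -
    have J': "J \<subseteq> K" "card J = r" "J \<subseteq> I" using J I(4) by (auto simp: \<J>_def)
    have HJ: "H J \<subseteq> J" by (auto simp: H_def)
    have finH: "finite (H J)" using HJ J' I(1) by (meson finite_subset)
    obtain e d where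
      orth: "\<forall>i\<in>J. \<forall>j\<in>J. inner_n n (e i) (e j) = (if i = j then 1 else 0)" and
      tri: "\<forall>l\<in>J. \<forall>i\<in>J. i < l \<longrightarrow> inner_n n (p l) (e i) = 0" and
      frame: "\<forall>i\<in>J. 0 < d i \<and> inner_n n (p i) (e i) = 1 / d i \<and>
        (\<forall>Q \<subseteq> (I - J) \<union> {j\<in>J. j < i}. d i \<le> euclid_dist_set n (w i) (span (w ` Q)))"
      using partial_gram_schmidt[OF I(1-3) J'(3) dual'] by (elim exE conjE) (rule that)
    have diag: "0 < d i" "inner_n n (p i) (e i) = 1 / d i" if "i \<in> J" for i
      using frame that by auto
    have dist: "d i \<le> euclid_dist_set n (w i) (span (w ` Q))"
      if "i \<in> J" "Q \<subseteq> (I - J) \<union> {j\<in>J. j < i}" for i Q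
      using frame that by blast
    have dD: "d i \<le> D" if "i \<in> H J" for i
    proof -
      have "i \<in> J" "(K - J) \<union> {j\<in>J. j < i} \<subseteq> (I - J) \<union> {j\<in>J. j < i}"
        using that I(4) by (auto simp: H_def)
      from dist[OF this] show ?thesis
        using that by (simp add: H_def)
    qed
    have "(\<integral>\<^sup>+x. ennreal (g J x) \<partial>?G)
        \<le> (\<Prod>i\<in>H J. ennreal (sqrt (2 * pi) / (2 * (\<Sum>a\<in>{1..n}. (\<theta> * p i a) * e i a))))"
      unfolding g_def
    proof (rule gauss_cauchy_product_le[OF _ finH])
      fix i j assume "i \<in> H J" "j \<in> H J"
      then show "(\<Sum>a\<in>{1..n}. e i a * e j a) = (if i = j then 1 else 0)"
        using orth HJ unfolding inner_n_def by blast
      show "(\<Sum>a\<in>{1..n}. (\<theta> * p i a) * e j a) = 0" if "j < i"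
        unfolding lin using tri HJ \<open>i \<in> H J\<close> \<open>j \<in> H J\<close> that by (metis mult_zero_right subsetD)
      show "0 < (\<Sum>a\<in>{1..n}. (\<theta> * p i a) * e i a)"
        unfolding lin using diag[of i] HJ \<open>i \<in> H J\<close> \<theta> by auto
    qed auto
    also have "\<dots> = ennreal (\<Prod>i\<in>H J. sqrt (2 * pi) / (2 * (\<theta> * (1 / d i))))"
      unfolding lin using HJ diag \<theta>
      by (subst prod_ennreal) (auto intro!: prod.cong divide_nonneg_nonneg mult_nonneg_nonneg simp: subset_iff less_imp_le)
    also have "\<dots> \<le> ennreal (\<Prod>i\<in>H J. exp (- 4))"
    proof (intro ennreal_leI prod_mono conjI)
      fix i assume i: "i \<in> H J"
      then have di: "0 < d i" using diag HJ by auto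
      show "0 \<le> sqrt (2 * pi) / (2 * (\<theta> * (1 / d i)))" using di \<theta> by simp
      have "sqrt (2 * pi) / (2 * (\<theta> * (1 / d i))) = exp (- 4) * ((sqrt (2 * pi) / 4) * (d i / D))"
        using di D by (simp add: \<theta>_def exp_minus field_simps)
      also have "\<dots> \<le> exp (- 4) * (1 * 1)"
        using sqrt_2_pi_le di D dD[OF i] by (intro mult_left_mono mult_mono) auto
      finally show "sqrt (2 * pi) / (2 * (\<theta> * (1 / d i))) \<le> exp (- 4)" by simp
    qed
    also have "(\<Prod>i\<in>H J. exp (- 4)) = exp (- 4 * real (card (H J)))"
      by (simp add: exp_of_nat_mult[symmetric] mult.commute)
    also have "ennreal \<dots> \<le> ennreal (exp (- 2 * real r))"
      using short[OF J'(1,2)] by (intro ennreal_leI) (simp add: H_def[symmetric])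
    finally show ?thesis .
  qed
  have Fint: "(\<integral>\<^sup>+x. ennreal (c * (\<Sum>J\<in>\<J>. g J x)) \<partial>?G) \<le> ennreal (exp (- real r))"
  proof -
    have "(\<integral>\<^sup>+x. ennreal (c * (\<Sum>J\<in>\<J>. g J x)) \<partial>?G) = (\<integral>\<^sup>+x. ennreal c * (\<Sum>J\<in>\<J>. ennreal (g J x)) \<partial>?G)"
      using c g0 by (simp add: ennreal_mult' sum_ennreal)
    also have "\<dots> = ennreal c * (\<Sum>J\<in>\<J>. \<integral>\<^sup>+x. ennreal (g J x) \<partial>?G)"
      by (subst nn_integral_cmult, measurable) (subst nn_integral_sum, auto)
    also have "\<dots> \<le> ennreal c * (\<Sum>J\<in>\<J>. ennreal (exp (- 2 * real r)))"
      by (intro mult_left_mono sum_mono g_int) auto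
    also have "\<dots> = ennreal (c * (C * exp (- 2 * real r)))"
      using c by (simp add: cardJ C_def ennreal_mult ennreal_of_nat_eq_real_of_nat)
    also have "\<dots> = ennreal (exp (real r * (\<theta> * R) / N - 2 * real r))"
      using C by (simp add: c_def exp_diff exp_minus field_simps)
    also have "\<dots> \<le> ennreal (exp (- real r))"
    proof -
      have "real r * (\<theta> * R) \<le> real r * N"
        using small by (intro mult_left_mono) (auto simp: \<theta>_def N_def)
      then have "real r * (\<theta> * R) / N \<le> real r" using N by (simp add: divide_le_eq)
      then show ?thesis by (intro ennreal_leI) simp
    qed
    finally show ?thesis .
  qed
  have F1: "1 \<le> c * (\<Sum>J\<in>\<J>. g J x)"
    if z: "z \<in> convex hull (\<Union>i\<in>I. {w i, - w i})" and x: "\<forall>a\<in>{1..n}. x a = (R *\<^sub>R z) a" for x z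
  proof -
    obtain b where b: "z = (\<Sum>i\<in>I. b i *\<^sub>R w i)" "(\<Sum>i\<in>I. \<bar>b i\<bar>) \<le> 1"
      using cross_polytope_coefficients[OF I(1) z] by auto
    have coef: "inner_n n (p l) x = R * b l" if l: "l \<in> I" for l
    proof -
      have "inner_n n (p l) x = inner_n n (p l) (R *\<^sub>R z)" using x by (intro inner_n_cong) auto
      also have "\<dots> = R * (\<Sum>i\<in>I. b i * inner_n n (p l) (w i))"
        by (simp only: b(1) inner_n_simps inner_n_sum_right)
      also have "(\<Sum>i\<in>I. b i * inner_n n (p l) (w i)) = (\<Sum>i\<in>I. if i = l then b l else 0)"
        using l by (intro sum.cong refl) (auto simp: dual)
      finally show ?thesis using l I(1) by simp
    qed
    define y where "y l = \<theta> * R * \<bar>b l\<bar>" for l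
    have y0: "0 \<le> y l" for l using \<theta> R by (simp add: y_def)
    have "sum y K \<le> sum y I" using I y0 by (intro sum_mono2) auto
    also have "\<dots> \<le> \<theta> * R * 1"
      unfolding y_def sum_distrib_left[symmetric] using b(2) \<theta> R by (intro mult_left_mono) auto
    finally have "C * exp (- (real r * (\<theta> * R) / N)) \<le> (\<Sum>J\<in>\<J>. exp (- sum y J))"
      unfolding C_def N_def \<J>_def using r by (intro subset_average_exp_ge finI1) auto
    also have "\<dots> \<le> (\<Sum>J\<in>\<J>. g J x)"
    proof (rule sum_mono)
      fix J assume "J \<in> \<J>"
      then have J: "J \<subseteq> I" "finite J" using I(4) finI1 by (auto simp: \<J>_def intro: finite_subset)
      have HJ: "H J \<subseteq> J" by (auto simp: H_def)
      have "exp (- sum y J) \<le> exp (- sum y (H J))"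
        using sum_mono2[OF J(2) HJ, of y] y0 by simp
      also have "\<dots> = (\<Prod>l\<in>H J. exp (- y l))"
        using finite_subset[OF HJ J(2)] by (simp add: exp_sum sum_negf[symmetric])
      also have "\<dots> \<le> g J x"
        unfolding g_def
      proof (intro prod_mono conjI)
        fix l assume "l \<in> H J"
        then have l: "l \<in> I" using HJ J by auto
        have "(\<Sum>a\<in>{1..n}. (\<theta> * p l a) * x a) = \<theta> * (R * b l)" by (simp only: lin coef[OF l])
        moreover have "y l = \<bar>\<theta> * (R * b l)\<bar>" using \<theta> R by (simp add: y_def abs_mult)
        ultimately have "1 + (\<Sum>a\<in>{1..n}. (\<theta> * p l a) * x a)\<^sup>2 \<le> exp (y l)"
          using one_plus_square_le_exp_abs[of "\<theta> * (R * b l)"] by simp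
        then have "1 / exp (y l) \<le> 1 / (1 + (\<Sum>a\<in>{1..n}. (\<theta> * p l a) * x a)\<^sup>2)"
          by (intro divide_left_mono mult_pos_pos) (auto simp: add_pos_nonneg)
        then show "exp (- y l) \<le> 1 / (1 + (\<Sum>a\<in>{1..n}. (\<theta> * p l a) * x a)\<^sup>2)"
          by (simp add: exp_minus inverse_eq_divide)
      qed auto
      finally show "exp (- sum y J) \<le> g J x" .
    qed
    finally have "c * (C * exp (- (real r * (\<theta> * R) / N))) \<le> c * (\<Sum>J\<in>\<J>. g J x)"
      using c by (intro mult_left_mono) auto
    moreover have "c * (C * exp (- (real r * (\<theta> * R) / N))) = 1"
      using C by (simp add: c_def exp_minus)
    ultimately show ?thesis by simp
  qed
  show ?thesis
    unfolding has_majorant_def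
  proof (intro bexI[of _ "\<lambda>x. c * (\<Sum>J\<in>\<J>. g J x)"] conjI allI ballI impI)
    show "0 \<le> c * (\<Sum>J\<in>\<J>. g J x)" for x
      using c g0 by (intro mult_nonneg_nonneg sum_nonneg) auto
    show "1 \<le> c * (\<Sum>J\<in>\<J>. g J x)"
      if y: "y \<in> (\<lambda>x. R *\<^sub>R x) ` (convex hull (\<Union>i\<in>I. {w i, - w i}))"
        and xy: "\<forall>a\<in>{1..n}. x a = y a" for x y
    proof -
      obtain z where z: "z \<in> convex hull (\<Union>i\<in>I. {w i, - w i})" and yz: "y = R *\<^sub>R z"
        using y by (elim imageE)
      show ?thesis
        by (rule F1[OF z xy[unfolded yz]])
    qed
    show "(\<lambda>x. c * (\<Sum>J\<in>\<J>. g J x)) \<in> borel_measurable ?G"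
      by measurable
  qed (rule Fint)
qed

lemma has_majorant_cross_polytope:
  fixes w :: "nat \<Rightarrow> vec"
  assumes I: "finite I" "card I = n" "w ` I \<subseteq> coord_space n" "K \<subseteq> I"
    and r: "1 \<le> r" "r \<le> card K" and D: "0 < D" and R: "0 \<le> R"
    and short: "\<And>J. indep_family w I \<Longrightarrow> J \<subseteq> K \<Longrightarrow> card J = r \<Longrightarrow> real r / 2
      \<le> real (card {j \<in> J. euclid_dist_set n (w j) (span (w ` ((K - J) \<union> {i \<in> J. i < j}))) \<le> D})"
    and small: "2 * exp 4 * D * R \<le> real (card K)"
  shows "has_majorant n ((\<lambda>x. R *\<^sub>R x) ` (convex hull (\<Union>i\<in>I. {w i, - w i}))) (exp (- real r))"
proof (cases "indep_family w I")
  case True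
  then show ?thesis
    using assms by (intro has_majorant_independent[where K = K and D = D]) auto
next
  case False
  then obtain e where e: "inner_n n e e > 0" "\<And>i. i \<in> I \<Longrightarrow> inner_n n e (w i) = 0"
    using orthogonal_vector_of_dependent_family[OF I(1-3)] by blast
  show ?thesis
  proof (rule has_majorant_dependent[OF e(1)])
    fix y assume "y \<in> (\<lambda>x. R *\<^sub>R x) ` (convex hull (\<Union>i\<in>I. {w i, - w i}))"
    then obtain z where z: "y = R *\<^sub>R z" "z \<in> convex hull (\<Union>i\<in>I. {w i, - w i})" by auto
    obtain b where "z = (\<Sum>i\<in>I. b i *\<^sub>R w i)"
      using cross_polytope_coefficients[OF I(1) z(2)] by auto
    then have "inner_n n e y = R * (\<Sum>i\<in>I. b i * inner_n n e (w i))"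
      by (simp only: z(1) inner_n_simps inner_n_sum_right)
    then show "inner_n n e y = 0" using e(2) by simp
  qed simp
qed

section \<open>Counting index sets and binomial estimates\<close>

text \<open>
  An index set is determined by its lower part, of size \<open>n - k\<close>, and its upper part, of size \<open>k\<close>.
\<close>

lemma index_sets_of_type:
  assumes "k \<le> n"
  defines "\<I> \<equiv> {I. I \<subseteq> {1..2*n} \<and> card I = n \<and> card (I \<inter> {n+1..2*n}) = k}"
  shows "finite \<I>" "card \<I> \<le> (n choose k)\<^sup>2" "\<And>I. I \<in> \<I> \<Longrightarrow> card (I \<inter> {1..n}) = n - k"
proof -
  have "\<I> \<subseteq> Pow {1..2*n}" by (auto simp: \<I>_def)
  then show "finite \<I>" by (rule finite_subset) simp
  show low: "card (I \<inter> {1..n}) = n - k" if "I \<in> \<I>" for I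
  proof -
    have I: "I \<subseteq> {1..2*n}" "card I = n" "card (I \<inter> {n+1..2*n}) = k" using that by (auto simp: \<I>_def)
    have "finite I" using I(1) by (rule finite_subset) simp
    moreover have "I = (I \<inter> {1..n}) \<union> (I \<inter> {n+1..2*n})"
      using I(1) by (auto simp: subset_iff)
    ultimately have "card I = card (I \<inter> {1..n}) + card (I \<inter> {n+1..2*n})"
      by (subst card_Un_disjoint[symmetric]) auto
    then show ?thesis using I by simp
  qed
  let ?A = "{A. A \<subseteq> {1..n} \<and> card A = n - k}" and ?B = "{B. B \<subseteq> {n+1..2*n} \<and> card B = k}"
  have "card \<I> \<le> card (?A \<times> ?B)"
  proof (rule card_inj_on_le)
    show "inj_on (\<lambda>I. (I \<inter> {1..n}, I \<inter> {n+1..2*n})) \<I>"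
    proof (rule inj_onI)
      fix I I' assume II: "I \<in> \<I>" "I' \<in> \<I>"
        "(I \<inter> {1..n}, I \<inter> {n+1..2*n}) = (I' \<inter> {1..n}, I' \<inter> {n+1..2*n})"
      have "X = (X \<inter> {1..n}) \<union> (X \<inter> {n+1..2*n})" if "X \<in> \<I>" for X
        using that by (auto simp: \<I>_def subset_iff)
      from this[OF II(1)] this[OF II(2)] II(3) show "I = I'" by auto
    qed
    show "(\<lambda>I. (I \<inter> {1..n}, I \<inter> {n+1..2*n})) ` \<I> \<subseteq> ?A \<times> ?B"
      using low by (auto simp: \<I>_def)
    show "finite (?A \<times> ?B)" by simp
  qed
  also have "\<dots> = (n choose (n - k)) * (n choose k)"
    by (simp add: card_cartesian_product n_subsets)
  also have "\<dots> = (n choose k)\<^sup>2"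
    using assms(1) by (simp add: binomial_symmetric[symmetric] power2_eq_square)
  finally show "card \<I> \<le> (n choose k)\<^sup>2" .
qed

text \<open>
  Combines \<open>(n choose k) \<le> n\<^sup>k / k!\<close> with \<open>k\<^sup>k / k! \<le> exp k\<close>, a single term of the exponential series.
\<close>

lemma binomial_le_exp_power:
  assumes "1 \<le> k"
  shows "real (n choose k) \<le> (exp 1 * real n / real k) ^ k"
proof -
  have "real k ^ k / fact k \<le> exp (real k)"
  proof -
    have "(\<lambda>i. real k ^ i /\<^sub>R fact i) sums exp (real k)" by (rule exp_converges)
    then have "(\<Sum>i\<in>{k}. real k ^ i /\<^sub>R fact i) \<le> exp (real k)"
      using sum_le_suminf[of "\<lambda>i. real k ^ i /\<^sub>R fact i" "{k}"] by (simp add: sums_iff)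
    then show ?thesis by (simp add: divide_inverse mult.commute)
  qed
  then have *: "real k ^ k \<le> exp 1 ^ k * fact k"
    by (simp add: divide_le_eq exp_of_nat_mult[symmetric])
  have "real (n choose k) * fact k \<le> real n ^ k"
    using binomial_fact_pow[of n k] by (metis of_nat_fact of_nat_le_iff of_nat_mult of_nat_power)
  then have "real (n choose k) * (real k ^ k * fact k) \<le> real n ^ k * (exp 1 ^ k * fact k)"
    using mult_mono[OF _ *, of "real (n choose k) * fact k" "real n ^ k"] by (simp add: mult_ac)
  then show ?thesis
    using assms by (simp add: power_mult_distrib power_divide field_simps)
qed

text \<open>
  Half of the term \<open>4 st ln (e n / st)\<close> cancels the power. As the logarithm is at least one, the
  other half is at least \<open>st\<close> and absorbs the factor \<open>st + 1\<close>; the term \<open>ln 16\<close> fixes the constant.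
\<close>

lemma binomial_tail_le_quarter:
  fixes st n :: nat and R :: real
  assumes "1 \<le> st" "real st \<le> real n / 2" "R \<ge> 4 * real st * ln (exp 1 * real n / real st) + ln 16"
  shows "2 * (real st + 1) * exp (- R) * (exp 1 * real n / real st) ^ (2 * st) \<le> 1 / 4"
proof -
  let ?x = "exp 1 * real n / real st"
  have st: "real st \<ge> 1" using assms(1) by simp
  have "exp 1 * 1 \<le> exp 1 * (real n / real st)"
    using assms(2) st by (intro mult_left_mono) (auto simp: field_simps)
  then have x: "exp 1 \<le> ?x" by simp
  then have x0: "?x > 0" using exp_gt_zero[of "1::real"] by linarith
  have L: "ln ?x \<ge> 1" using x x0 by (simp add: ln_ge_iff)
  have "?x ^ (2 * st) = exp (2 * real st * ln ?x)"
    using x0 by (simp add: exp_of_nat_mult[of "2 * st", simplified])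
  moreover have "exp (- R) \<le> exp (- (4 * real st * ln ?x)) * (1 / 16)"
  proof -
    have "exp (- R) \<le> exp (- (4 * real st * ln ?x) + - ln 16)" using assms(3) by simp
    then show ?thesis unfolding exp_add by (simp add: exp_minus)
  qed
  ultimately have "exp (- R) * ?x ^ (2 * st) \<le> exp (- (4 * real st * ln ?x)) * (1 / 16) * exp (2 * real st * ln ?x)"
    by (intro mult_mono) (use x0 in auto)
  also have "\<dots> = exp (- (2 * real st * ln ?x)) / 16"
    by (simp add: exp_add[symmetric])
  also have "\<dots> \<le> exp (- real st) / 16"
  proof -
    have "real st * 1 \<le> 2 * real st * ln ?x" using L st by (intro mult_mono) auto
    then show ?thesis by simp
  qed
  finally have "2 * (real st + 1) * (exp (- R) * ?x ^ (2 * st)) \<le> 2 * (real st + 1) * (exp (- real st) / 16)"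
    by (intro mult_left_mono) auto
  also have "(real st + 1) * exp (- real st) \<le> 1"
    using exp_ge_add_one_self[of "real st"] by (simp add: exp_minus field_simps)
  then have "2 * (real st + 1) * (exp (- real st) / 16) \<le> 1 / 4"
    by (simp add: algebra_simps)
  finally show ?thesis by (simp add: mult.assoc)
qed

section \<open>The measure bound under the suppression event\<close>

lemma w_vec_in_coord_space: "w_vec n m s A \<omega> i \<in> coord_space n"
  by (auto simp: w_vec_def v_vec_def u_vec_def prod_col_def coord_space_def)

text \<open>
  For each index set the event is applied to the part of \<open>I\<close> in \<open>{1..n}\<close>, on which \<open>w\<close> agrees
  with \<open>v\<close>. The constant 16 is \<open>2 \<cdot> 2 \<cdot> 4\<close>: one factor 2 belongs to \<open>\<theta> = 2e\<^sup>4D\<close>, the other comes from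
  \<open>n - k \<ge> n/2\<close>, and 4 is the dilation factor in front of \<open>\<rho>\<close>.
\<close>

lemma p_k_le:
  assumes event: "\<Gamma> \<in> E_A n m s Cstar r st A" and \<omega>: "\<omega> = sub_cols n (S_set n m A) \<Gamma>"
    and k: "k \<le> st" "2 * st \<le> n" and r: "1 \<le> r" "r \<le> n - st"
    and pos: "0 < Cstar" "0 \<le> \<rho>" and small: "16 * exp 4 * \<rho> * Cstar * sqrt (real r) \<le> real n"
  shows "p_k n m s \<rho> k A \<omega> \<le> real (n choose k) ^ 2 * exp (- real r)"
proof -
  let ?\<I> = "{I. I \<subseteq> {1..2*n} \<and> card I = n \<and> card (I \<inter> {n+1..2*n}) = k}"
  define w where "w = w_vec n m s A \<omega>"
  define v where "v = v_vec n m s A \<omega>"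
  have ev: "\<forall>I1. I1 \<subseteq> {1..n} \<and> card I1 = n - k \<and> indep_family v I1 \<longrightarrow>
         (\<forall>J. J \<subseteq> I1 \<and> card J = r \<longrightarrow>
            real (card {l \<in> {n - k - r + 1..n - k}.
              euclid_dist_set n (v (sigma_ord I1 J l))
                (span {v (sigma_ord I1 J t) |t. 1 \<le> t \<and> t < l}) \<le> Cstar * sqrt (real r)})
            \<ge> real r / 2)"
  proof -
    have "k \<in> {0..st}" using k by simp
    with event show ?thesis
      unfolding E_A_def v_def \<omega> Let_def mem_Collect_eq
      by (elim conjE) (drule bspec[where x = k], assumption+)
  qed
  have kn: "k \<le> n" using k by simp
  have vw: "v i = w i" if "i \<le> n" for i
    using that by (simp add: v_def w_def w_vec_def)
  have "has_majorant n ((\<lambda>x. (4 * \<rho>) *\<^sub>R x) ` P_I n m s I A \<omega>) (exp (- real r))" if I: "I \<in> ?\<I>" for I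
    unfolding P_I_def w_def[symmetric]
  proof (rule has_majorant_cross_polytope[where K = "I \<inter> {1..n}" and D = "Cstar * sqrt (real r)"])
    have card1: "card (I \<inter> {1..n}) = n - k" by (rule index_sets_of_type(3)[OF kn I])
    show fin: "finite I" using I by (auto intro: finite_subset)
    show "card I = n" using I by simp
    show "w ` I \<subseteq> coord_space n" by (auto simp: w_def w_vec_in_coord_space)
    show "r \<le> card (I \<inter> {1..n})" using card1 r k by simp
    show "0 < Cstar * sqrt (real r)" using pos r by simp
    show "2 * exp 4 * (Cstar * sqrt (real r)) * (4 * \<rho>) \<le> real (card (I \<inter> {1..n}))"
    proof -
      have "2 * (2 * exp 4 * (Cstar * sqrt (real r)) * (4 * \<rho>)) = 16 * exp 4 * \<rho> * Cstar * sqrt (real r)"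
        by simp
      moreover have "real n \<le> 2 * real (n - k)" using k by simp
      ultimately show ?thesis using small card1 by linarith
    qed
    show "real r / 2 \<le> real (card {j \<in> J. euclid_dist_set n (w j)
        (span (w ` ((I \<inter> {1..n} - J) \<union> {i \<in> J. i < j}))) \<le> Cstar * sqrt (real r)})"
      if indep: "indep_family w I" and J: "J \<subseteq> I \<inter> {1..n}" "card J = r" for J
    proof -
      let ?I1 = "I \<inter> {1..n}"
      have img: "v ` X = w ` X" if "X \<subseteq> {1..n}" for X
        using that vw by (intro image_cong) auto
      have "inj_on v ?I1"
        using indep vw unfolding indep_family_def inj_on_def by auto
      moreover have "independent (v ` ?I1)"
        using indep img[of ?I1] independent_mono[of "w ` I" "w ` ?I1"]
        unfolding indep_family_def by (simp add: image_mono)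
      ultimately have "indep_family v ?I1" by (simp add: indep_family_def)
      then have "real r / 2 \<le> real (card {l \<in> {n - k - r + 1..n - k}.
              euclid_dist_set n (v (sigma_ord ?I1 J l))
                (span {v (sigma_ord ?I1 J t) |t. 1 \<le> t \<and> t < l}) \<le> Cstar * sqrt (real r)})"
        by (intro ev[rule_format] conjI) (use J card1 in auto)
      also have "\<dots> \<le> real (card {j \<in> J. euclid_dist_set n (v j)
        (span (v ` ((?I1 - J) \<union> {i \<in> J. i < j}))) \<le> Cstar * sqrt (real r)})"
        using fin J card1 by (intro of_nat_mono card_sigma_ord_le) auto
      also have "{j \<in> J. euclid_dist_set n (v j) (span (v ` ((?I1 - J) \<union> {i \<in> J. i < j}))) \<le> Cstar * sqrt (real r)}
        = {j \<in> J. euclid_dist_set n (w j) (span (w ` ((?I1 - J) \<union> {i \<in> J. i < j}))) \<le> Cstar * sqrt (real r)}"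
      proof (rule Collect_cong, rule conj_cong[OF refl])
        fix j assume "j \<in> J"
        then have "v j = w j" using J vw by auto
        moreover have "v ` ((?I1 - J) \<union> {i \<in> J. i < j}) = w ` ((?I1 - J) \<union> {i \<in> J. i < j})"
          using J by (intro img) auto
        ultimately show "(euclid_dist_set n (v j) (span (v ` ((?I1 - J) \<union> {i \<in> J. i < j}))) \<le> Cstar * sqrt (real r))
          = (euclid_dist_set n (w j) (span (w ` ((?I1 - J) \<union> {i \<in> J. i < j}))) \<le> Cstar * sqrt (real r))"
          by simp
      qed
      finally show ?thesis .
    qed
  qed (use r pos in auto)
  then have "has_majorant n (\<Union>I\<in>?\<I>. (\<lambda>x. (4 * \<rho>) *\<^sub>R x) ` P_I n m s I A \<omega>) (real (card ?\<I>) * exp (- real r))"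
    by (intro has_majorant_UN index_sets_of_type(1)[OF kn]) auto
  then have "has_majorant n ((\<lambda>x. (4 * \<rho>) *\<^sub>R x) ` P_k n m s k A \<omega>) (real (card ?\<I>) * exp (- real r))"
    by (simp add: P_k_def image_UN)
  then have "p_k n m s \<rho> k A \<omega> \<le> real (card ?\<I>) * exp (- real r)"
    unfolding p_k_def by (intro gauss_measure_le_of_majorant) auto
  also have "\<dots> \<le> real ((n choose k)\<^sup>2) * exp (- real r)"
    by (intro mult_right_mono of_nat_mono index_sets_of_type(2)[OF kn]) auto
  finally show ?thesis by simp
qed

theorem proposition3p7:
  "\<exists>c_suppr c_decay Cbar :: real. c_suppr > 0 \<and> c_decay > 0 \<and> Cbar > 0 \<and>
    (\<forall>Cstar :: real. Cstar \<ge> Cbar \<longrightarrow>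
      (\<forall>(n::nat) (m::nat) (\<rho>::real) (\<epsilon>::real) (s::nat) (st::nat) (r::nat) (\<Gamma>::mat).
        n \<ge> 3 \<and> m = n ^ 3 \<and> \<rho> \<ge> 1 \<and> \<epsilon> = 1 / (\<rho> * real n ^ 2) \<and> 1 \<le> s \<and> s \<le> n \<and>
        1 \<le> st \<and> real st \<le> real n / 2 \<and> 8 \<le> r \<and> int r \<le> int n - int st \<and>
        \<Gamma> \<in> E_K n m \<epsilon> s Cstar r st \<and>
        4 * \<rho> * Cstar * sqrt (real r) \<le> c_suppr * real n \<longrightarrow>
        (\<forall>A\<in>A_eps n m \<epsilon>. \<forall>\<omega>. \<omega> = sub_cols n (S_set n m A) \<Gamma> \<longrightarrow>
          (\<forall>k\<in>{0..st}. p_k n m s \<rho> k A \<omega>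
              \<le> 2 * real (n choose k) ^ 2 * exp (- c_decay * real r)) \<and>
          (\<Sum>k=0..st. p_k n m s \<rho> k A \<omega>)
              \<le> 2 * (real st + 1) * exp (- c_decay * real r) * real (n choose st) ^ 2 \<and>
          2 * (real st + 1) * exp (- c_decay * real r) * real (n choose st) ^ 2
              \<le> 2 * (real st + 1) * exp (- c_decay * real r)
                  * (exp 1 * real n / real st) ^ (2 * st) \<and>
          (c_decay * real r \<ge> 4 * real st * ln (exp 1 * real n / real st) + ln 16 \<longrightarrow>
            (\<Sum>k=0..st. p_k n m s \<rho> k A \<omega>) \<le> 1 / 4))))"
proof (rule exI[of _ "1 / (4 * exp 4)"], rule exI[of _ 1], rule exI[of _ 1], intro conjI allI impI ballI)
  fix Cstar :: real and n m :: nat and \<rho> \<epsilon> :: real and s st r :: nat and \<Gamma> A \<omega> :: mat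
  assume Cstar: "Cstar \<ge> 1"
    and H: "n \<ge> 3 \<and> m = n ^ 3 \<and> \<rho> \<ge> 1 \<and> \<epsilon> = 1 / (\<rho> * real n ^ 2) \<and> 1 \<le> s \<and> s \<le> n \<and>
        1 \<le> st \<and> real st \<le> real n / 2 \<and> 8 \<le> r \<and> int r \<le> int n - int st \<and>
        \<Gamma> \<in> E_K n m \<epsilon> s Cstar r st \<and>
        4 * \<rho> * Cstar * sqrt (real r) \<le> 1 / (4 * exp 4) * real n"
    and A: "A \<in> A_eps n m \<epsilon>" and \<omega>: "\<omega> = sub_cols n (S_set n m A) \<Gamma>"
  let ?p = "\<lambda>k. p_k n m s \<rho> k A \<omega>"
  have event: "\<Gamma> \<in> E_A n m s Cstar r st A"
    using H A by (auto simp: E_K_def)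
  have st: "1 \<le> st" "2 * st \<le> n" using H by auto
  \<comment> \<open>The value \<open>c_suppr = 1/(4e\<^sup>4)\<close> is chosen to make the smallness hypothesis equivalent to this form.\<close>
  have small: "16 * exp 4 * \<rho> * Cstar * sqrt (real r) \<le> real n"
    using H by (simp add: field_simps)
  have each: "?p k \<le> 2 * real (n choose k) ^ 2 * exp (- 1 * real r)" if "k \<in> {0..st}" for k
  proof -
    have "?p k \<le> real (n choose k) ^ 2 * exp (- real r)"
      using that H Cstar by (intro p_k_le[OF event \<omega> _ st(2) _ _ _ _ small]) auto
    also have "\<dots> \<le> 2 * (real (n choose k) ^ 2 * exp (- real r))" by simp
    finally show ?thesis by (simp add: mult.assoc)
  qed
  then show "k \<in> {0..st} \<Longrightarrow> ?p k \<le> 2 * real (n choose k) ^ 2 * exp (- 1 * real r)" for k .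
  have "(\<Sum>k=0..st. ?p k) \<le> (\<Sum>k=0..st. 2 * real (n choose st) ^ 2 * exp (- 1 * real r))"
  proof (rule sum_mono)
    fix k assume k: "k \<in> {0..st}"
    have "real (n choose k) ^ 2 \<le> real (n choose st) ^ 2"
      using k st by (intro power_mono of_nat_mono binomial_mono) auto
    then have "2 * real (n choose k) ^ 2 * exp (- 1 * real r) \<le> 2 * real (n choose st) ^ 2 * exp (- 1 * real r)"
      by (intro mult_right_mono mult_left_mono) auto
    with each[OF k] show "?p k \<le> 2 * real (n choose st) ^ 2 * exp (- 1 * real r)" by linarith
  qed
  also have "\<dots> = 2 * (real st + 1) * exp (- 1 * real r) * real (n choose st) ^ 2"
    by (simp add: mult_ac)
  finally show total: "(\<Sum>k=0..st. ?p k) \<le> 2 * (real st + 1) * exp (- 1 * real r) * real (n choose st) ^ 2" .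
  have "real (n choose st) ^ 2 \<le> ((exp 1 * real n / real st) ^ st) ^ 2"
    using st by (intro power_mono binomial_le_exp_power) auto
  also have "\<dots> = (exp 1 * real n / real st) ^ (2 * st)"
    by (simp add: power_mult[symmetric] mult.commute)
  finally show binom: "2 * (real st + 1) * exp (- 1 * real r) * real (n choose st) ^ 2
      \<le> 2 * (real st + 1) * exp (- 1 * real r) * (exp 1 * real n / real st) ^ (2 * st)"
    by (intro mult_left_mono) auto
  show "(\<Sum>k=0..st. ?p k) \<le> 1 / 4"
    if "1 * real r \<ge> 4 * real st * ln (exp 1 * real n / real st) + ln 16"
  proof -
    have "2 * (real st + 1) * exp (- 1 * real r) * (exp 1 * real n / real st) ^ (2 * st) \<le> 1 / 4"
      using binomial_tail_le_quarter[of st n "real r"] that H by simp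
    with total binom show ?thesis by linarith
  qed
qed auto

end
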